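(* For $d\in\mathbb Z_+=\{1,2,\dots\}$, let $SF_d^+$ denote the even symplectic fermion vertex operator algebra. Then there exists $\mathbb M\in\mathrm{Mod}(SF_d^+)$ that is not lowest generated.
   Context: The even symplectic fermion VOA $SF_d^+$: let $\mathfrak h$ be a $2d$-dimensional complex vector space with a symplectic form $\langle\cdot,\cdot\rangle$ and basis $e^1,\dots,e^d,f^1,\dots,f^d$ with $\langle e^i,f^j\rangle=\delta_{ij}$, $\langle e^i,e^j\rangle=\langle f^i,f^j\rangle=0$. The symplectic fermion vertex operator superalgebra $SF_d$ is the Fock space $\Lambda(\mathfrak h\otimes t^{-1}\mathbb C[t^{-1}])\mathbf 1$ generated by odd fields $a(z)=\sum_{n\in\mathbb Z}a_nz^{-n-1}$ ($a\in\mathfrak h$) with $a_mb_n+b_na_m=m\langle a,b\rangle\delta_{m+n,0}$, $a_n\mathbf 1=0$ for $n\geq0$, and conformal vector $\sum_{i=1}^df^i_{-1}e^i_{-1}\mathbf 1$ (central charge $-2d$). $SF_d^+$ is the even (parity-zero) part of $SF_d$; it is an $\mathbb N$-graded $C_2$-cofinite vertex operator algebra. For an $\mathbb N$-graded $C_2$-cofinite vertex operator algebra $\mathbb V$, $\mathrm{Mod}(\mathbb V)$ is the category of grading-restricted generalized $\mathbb V$-modules: weak modules $\mathbb W=\bigoplus_{\lambda\in\mathbb C}\mathbb W_{[\lambda]}$ with $\mathbb W_{[\lambda]}$ the generalized $L(0)$-eigenspaces, such that $\bigoplus_{\mathrm{Re}(\mu)\le\mathrm{Re}(\lambda)}\mathbb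 W_{[\mu]}$ is finite dimensional for each $\lambda$. Write $Y(v,z)=\sum_{n\in\mathbb Z}Y(v)_nz^{-n-1}$. For a weak $\mathbb V$-module $\mathbb X$, $\Omega(\mathbb X)=\{w\in\mathbb X: Y(v)_nw=0$ for all homogeneous $v\in\mathbb V$ and $n\in\mathbb Z$ with $\mathrm{wt}(v)-n-1<0\}$. $\mathbb X$ is lowest generated if it is generated by $\Omega(\mathbb X)$ as a $\mathbb V$-module. *)

theory Defs
  imports Complex_Main "HOL-Library.Groups_Big_Fun" "HOL-Library.Function_Algebras"
begin

text \<open>
  All spaces are complex subspaces (carriers) of an ambient vector space whose type is of class
  \<^class>\<open>ab_group_add\<close> and whose scalar multiplication is a record field. The field \<open>Y\<close> gives the
  modes: \<open>Y V u n v\<close> is the coefficient of $z^{-n-1}$ in $Y(u,z)v$, and likewise \<open>YM\<close> for modules.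
\<close>

record 'v voa =
  vscale :: "complex \<Rightarrow> 'v \<Rightarrow> 'v"
  vcarrier :: "'v set"
  Y :: "'v \<Rightarrow> int \<Rightarrow> 'v \<Rightarrow> 'v"
  vac :: 'v
  conf :: 'v

text \<open>\<open>parity V 0\<close> and \<open>parity V 1\<close> are the even and the odd subspace.\<close>

record 'v vosa = "'v voa" +
  parity :: "nat \<Rightarrow> 'v set"

definition L :: "('v, 'x) voa_scheme \<Rightarrow> int \<Rightarrow> 'v \<Rightarrow> 'v" where
  "L V n v = Y V (conf V) (n + 1) v"

definition weight_space :: "('v, 'x) voa_scheme \<Rightarrow> int \<Rightarrow> 'v set" where
  "weight_space V k = {v \<in> vcarrier V. L V 0 v = vscale V (of_int k) v}"

definition fin_dim :: "(complex \<Rightarrow> 'v::ab_group_add \<Rightarrow> 'v) \<Rightarrow> 'v set \<Rightarrow> bool" where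
  "fin_dim sc S \<longleftrightarrow> (\<exists>B. finite B \<and> S \<subseteq> module.span sc B)"

text \<open>
  The coefficients of the Jacobi identity
  \[ z_0^{-1}\delta\Bigl(\frac{z_1-z_2}{z_0}\Bigr)Y(u,z_1)Y(v,z_2)w
     - \varepsilon z_0^{-1}\delta\Bigl(\frac{z_2-z_1}{-z_0}\Bigr)Y(v,z_2)Y(u,z_1)w
     = z_2^{-1}\delta\Bigl(\frac{z_1-z_0}{z_2}\Bigr)Y(Y_V(u,z_0)v,z_2)w \]
  at $z_0^{-l-1}z_1^{-m-1}z_2^{-n-1}$. The sums over \<open>i\<close> have finite support by the truncation
  axiom that accompanies every use.
\<close>

definition jacobi ::
  "(complex \<Rightarrow> 'w::ab_group_add \<Rightarrow> 'w) \<Rightarrow> ('v \<Rightarrow> int \<Rightarrow> 'v \<Rightarrow> 'v) \<Rightarrow> ('v \<Rightarrow> int \<Rightarrow> 'w \<Rightarrow> 'w)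
    \<Rightarrow> complex \<Rightarrow> 'v \<Rightarrow> 'v \<Rightarrow> 'w \<Rightarrow> bool" where
  "jacobi sc YV YW \<epsilon> u v w \<longleftrightarrow> (\<forall>l m n :: int.
     Sum_any (\<lambda>i. sc (of_int m gchoose i) (YW (YV u (l + int i) v) (m + n - int i) w)) =
     Sum_any (\<lambda>i. sc ((-1) ^ i * (of_int l gchoose i))
        (YW u (l + m - int i) (YW v (n + int i) w)
         - sc (\<epsilon> * (-1) powi l) (YW v (l + n - int i) (YW u (m + int i) w)))))"

locale vertex_superalgebra =
  fixes V :: "('v::ab_group_add) vosa"
  assumes vector_space: "vector_space (vscale V)"
    and parity_subspace: "p < 2 \<Longrightarrow> module.subspace (vscale V) (parity V p)"
    and parity_disjoint: "parity V 0 \<inter> parity V 1 = {0}"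
    and parity_sum: "vcarrier V = {u + v | u v. u \<in> parity V 0 \<and> v \<in> parity V 1}"
    and mode_parity: "\<lbrakk>p < 2; q < 2; u \<in> parity V p; v \<in> parity V q\<rbrakk>
          \<Longrightarrow> Y V u n v \<in> parity V ((p + q) mod 2)"
    and mode_add_left: "\<lbrakk>u \<in> vcarrier V; u' \<in> vcarrier V; v \<in> vcarrier V\<rbrakk>
          \<Longrightarrow> Y V (u + u') n v = Y V u n v + Y V u' n v"
    and mode_scale_left: "\<lbrakk>u \<in> vcarrier V; v \<in> vcarrier V\<rbrakk>
          \<Longrightarrow> Y V (vscale V c u) n v = vscale V c (Y V u n v)"
    and mode_add_right: "\<lbrakk>u \<in> vcarrier V; v \<in> vcarrier V; v' \<in> vcarrier V\<rbrakk>
          \<Longrightarrow> Y V u n (v + v') = Y V u n v + Y V u n v'"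
    and mode_scale_right: "\<lbrakk>u \<in> vcarrier V; v \<in> vcarrier V\<rbrakk>
          \<Longrightarrow> Y V u n (vscale V c v) = vscale V c (Y V u n v)"
    and truncation: "\<lbrakk>u \<in> vcarrier V; v \<in> vcarrier V\<rbrakk> \<Longrightarrow> \<exists>N. \<forall>n\<ge>N. Y V u n v = 0"
    and vac_even: "vac V \<in> parity V 0"
    and vac_mode: "v \<in> vcarrier V \<Longrightarrow> Y V (vac V) n v = (if n = -1 then v else 0)"
    and creation: "v \<in> vcarrier V \<Longrightarrow> n \<ge> 0 \<Longrightarrow> Y V v n (vac V) = 0"
      "v \<in> vcarrier V \<Longrightarrow> Y V v (-1) (vac V) = v"
    and jacobi: "\<lbrakk>p < 2; q < 2; u \<in> parity V p; v \<in> parity V q; w \<in> vcarrier V\<rbrakk>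
          \<Longrightarrow> jacobi (vscale V) (Y V) (Y V) ((-1) ^ (p * q)) u v w"

text \<open>
  $\mathbb N$-graded, with finite-dimensional weight spaces and central charge \<open>c\<close>. Directness of
  the weight decomposition is automatic for eigenspaces.
\<close>

locale vertex_operator_superalgebra = vertex_superalgebra V
  for V :: "('v::ab_group_add) vosa" and c :: complex +
  assumes conf_even: "conf V \<in> parity V 0"
    and virasoro: "v \<in> vcarrier V \<Longrightarrow> L V m (L V n v) - L V n (L V m v) =
          vscale V (of_int (m - n)) (L V (m + n) v) +
          (if m + n = 0 then vscale V (of_int (m ^ 3 - m) / 12 * c) v else 0)"
    and derivative: "\<lbrakk>u \<in> vcarrier V; v \<in> vcarrier V\<rbrakk>
          \<Longrightarrow> Y V (L V (-1) u) n v = vscale V (- of_int n) (Y V u (n - 1) v)"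
    and grading: "vcarrier V = module.span (vscale V) (\<Union>k::nat. weight_space V (int k))"
    and weight_fin_dim: "fin_dim (vscale V) (weight_space V k)"

locale symplectic_space =
  fixes hscale :: "complex \<Rightarrow> 'h::ab_group_add \<Rightarrow> 'h"
    and form :: "'h \<Rightarrow> 'h \<Rightarrow> complex"
    and d :: nat and e f :: "nat \<Rightarrow> 'h"
  assumes h_vector_space: "vector_space hscale"
    and form_add: "form (a + a') b = form a b + form a' b"
    and form_scale: "form (hscale c a) b = c * form a b"
    and form_skew: "form a b = - form b a"
    and h_span: "module.span hscale (e ` {1..d} \<union> f ` {1..d}) = UNIV"
    and form_ef: "\<lbrakk>i \<in> {1..d}; j \<in> {1..d}\<rbrakk> \<Longrightarrow> form (e i) (f j) = (if i = j then 1 else 0)"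
    and form_ee: "\<lbrakk>i \<in> {1..d}; j \<in> {1..d}\<rbrakk> \<Longrightarrow> form (e i) (e j) = 0"
    and form_ff: "\<lbrakk>i \<in> {1..d}; j \<in> {1..d}\<rbrakk> \<Longrightarrow> form (f i) (f j) = 0"
begin

text \<open>
  The pairing conditions make the \<open>2 d\<close> vectors \<open>e i\<close>, \<open>f i\<close> linearly independent, so with
  \<open>h_span\<close> they form a basis and the form is nondegenerate.
\<close>

definition basis_vec :: "nat \<Rightarrow> 'h" where
  "basis_vec i = (if i \<le> d then e i else f (i - d))"

end

text \<open>
  Indices of the standard monomial basis of the exterior algebra of $\mathfrak h\otimes
  t^{-1}\mathbb C[t^{-1}]$: the pair \<open>(i, n)\<close> stands for the \<open>i\<close>-th basis vector of $\mathfrak h$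
  times $t^{-n}$, and the factors of a monomial strictly increase lexicographically.
\<close>

definition fock_words :: "nat \<Rightarrow> (nat \<times> nat) list set" where
  "fock_words d = {xs. set xs \<subseteq> {1..2 * d} \<times> {1..} \<and>
     sorted_wrt (\<lambda>(i, m) (j, n). i < j \<or> i = j \<and> m < n) xs}"

text \<open>
  \<open>st a\<close> is the state $a_{-1}\mathbf 1$ of $a\in\mathfrak h$, so that $a(z)=Y(a_{-1}\mathbf 1,z)$
  has the modes \<open>gen a n\<close>.
\<close>

locale odd_fields =
  symplectic_space hscale form d e f +
  vertex_operator_superalgebra SF "- 2 * of_nat d"
  for hscale :: "complex \<Rightarrow> 'h::ab_group_add \<Rightarrow> 'h" and form d e f
    and SF :: "('v::ab_group_add) vosa" +
  fixes st :: "'h \<Rightarrow> 'v"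
  assumes st_add: "st (a + b) = st a + st b"
    and st_scale: "st (hscale c a) = vscale SF c (st a)"
    and st_odd: "st a \<in> parity SF 1"
begin

definition gen :: "'h \<Rightarrow> int \<Rightarrow> 'v \<Rightarrow> 'v" where
  "gen a n = Y SF (st a) n"

definition fock_monomial :: "(nat \<times> nat) list \<Rightarrow> 'v" where
  "fock_monomial xs = foldr (\<lambda>(i, n). gen (basis_vec i) (- int n)) xs (vac SF)"

end

text \<open>
  \<open>SF\<close> is a symplectic fermion vertex operator superalgebra of rank \<open>d\<close>. The three \<open>fock\<close>
  conditions say that the standard monomials in the creation operators applied to the vacuum form
  a basis of \<open>SF\<close>, i.e. that \<open>SF\<close> is the exterior algebra of $\mathfrak h\otimes
  t^{-1}\mathbb C[t^{-1}]$ applied to the vacuum.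
\<close>

locale symplectic_fermion = odd_fields +
  assumes anticommutator: "v \<in> vcarrier SF \<Longrightarrow>
          gen a m (gen b n v) + gen b n (gen a m v) =
          (if m + n = 0 then vscale SF (of_int m * form a b) v else 0)"
    and annihilation: "n \<ge> 0 \<Longrightarrow> gen a n (vac SF) = 0"
    and fock_inj: "inj_on fock_monomial (fock_words d)"
    and fock_independent:
      "\<not> module.dependent (vscale SF) (fock_monomial ` fock_words d)"
    and fock_span:
      "module.span (vscale SF) (fock_monomial ` fock_words d) = vcarrier SF"
    and conf_eq: "conf SF = (\<Sum>i\<in>{1..d}. gen (f i) (-1) (gen (e i) (-1) (vac SF)))"

definition even_part :: "'v vosa \<Rightarrow> 'v voa" where
  "even_part V = \<lparr>vscale = vscale V, vcarrier = parity V 0, Y = Y V, vac = vac V, conf = conf V\<rparr>"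

record ('v, 'w) vmod =
  mscale :: "complex \<Rightarrow> 'w \<Rightarrow> 'w"
  mcarrier :: "'w set"
  YM :: "'v \<Rightarrow> int \<Rightarrow> 'w \<Rightarrow> 'w"

locale weak_module =
  fixes V :: "('v::ab_group_add) voa" and W :: "('v, 'w::ab_group_add) vmod"
  assumes vector_space: "vector_space (mscale W)"
    and subspace: "module.subspace (mscale W) (mcarrier W)"
    and mode_closed: "\<lbrakk>v \<in> vcarrier V; w \<in> mcarrier W\<rbrakk> \<Longrightarrow> YM W v n w \<in> mcarrier W"
    and mode_add_left: "\<lbrakk>v \<in> vcarrier V; v' \<in> vcarrier V; w \<in> mcarrier W\<rbrakk>
          \<Longrightarrow> YM W (v + v') n w = YM W v n w + YM W v' n w"
    and mode_scale_left: "\<lbrakk>v \<in> vcarrier V; w \<in> mcarrier W\<rbrakk>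
          \<Longrightarrow> YM W (vscale V c v) n w = mscale W c (YM W v n w)"
    and mode_add_right: "\<lbrakk>v \<in> vcarrier V; w \<in> mcarrier W; w' \<in> mcarrier W\<rbrakk>
          \<Longrightarrow> YM W v n (w + w') = YM W v n w + YM W v n w'"
    and mode_scale_right: "\<lbrakk>v \<in> vcarrier V; w \<in> mcarrier W\<rbrakk>
          \<Longrightarrow> YM W v n (mscale W c w) = mscale W c (YM W v n w)"
    and truncation: "\<lbrakk>v \<in> vcarrier V; w \<in> mcarrier W\<rbrakk> \<Longrightarrow> \<exists>N. \<forall>n\<ge>N. YM W v n w = 0"
    and vac_mode: "w \<in> mcarrier W \<Longrightarrow> YM W (vac V) n w = (if n = -1 then w else 0)"
    and jacobi: "\<lbrakk>u \<in> vcarrier V; v \<in> vcarrier V; w \<in> mcarrier W\<rbrakk>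
          \<Longrightarrow> jacobi (mscale W) (Y V) (YM W) 1 u v w"

definition gen_weight_space :: "'v voa \<Rightarrow> ('v, 'w::ab_group_add) vmod \<Rightarrow> complex \<Rightarrow> 'w set" where
  "gen_weight_space V W \<mu> = {w \<in> mcarrier W.
     \<exists>k::nat. ((\<lambda>x. YM W (conf V) 1 x - mscale W \<mu> x) ^^ k) w = 0}"

text \<open>
  Generalized eigenspaces of $L(0)=Y_W(\omega)_1$ for distinct eigenvalues are independent, so the
  spans below are direct sums.
\<close>

definition Mod :: "('v::ab_group_add) voa \<Rightarrow> ('v, 'w::ab_group_add) vmod set" where
  "Mod V = {W. weak_module V W \<and>
     mcarrier W = module.span (mscale W) (\<Union>\<mu>. gen_weight_space V W \<mu>) \<and>
     (\<forall>r. fin_dim (mscale W)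
        (module.span (mscale W) (\<Union>\<mu>\<in>{\<mu>. Re \<mu> \<le> Re r}. gen_weight_space V W \<mu>)))}"

definition Omega :: "'v voa \<Rightarrow> ('v, 'w::ab_group_add) vmod \<Rightarrow> 'w set" where
  "Omega V W = {w \<in> mcarrier W.
     \<forall>k n. \<forall>v\<in>weight_space V k. k - n - 1 < 0 \<longrightarrow> YM W v n w = 0}"

definition submodule :: "'v voa \<Rightarrow> ('v, 'w::ab_group_add) vmod \<Rightarrow> 'w set \<Rightarrow> bool" where
  "submodule V W U \<longleftrightarrow> U \<subseteq> mcarrier W \<and> module.subspace (mscale W) U \<and>
     (\<forall>v\<in>vcarrier V. \<forall>n. \<forall>u\<in>U. YM W v n u \<in> U)"

definition generated_submodule :: "'v voa \<Rightarrow> ('v, 'w::ab_group_add) vmod \<Rightarrow> 'w set \<Rightarrow> 'w set" where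
  "generated_submodule V W S = \<Inter>{U. submodule V W U \<and> S \<subseteq> U}"

definition lowest_generated :: "'v voa \<Rightarrow> ('v, 'w::ab_group_add) vmod \<Rightarrow> bool" where
  "lowest_generated V W \<longleftrightarrow> generated_submodule V W (Omega V W) = mcarrier W"

text \<open>
  Objects of \<open>Mod V\<close> have at most countable dimension: for each integer \<open>n\<close> the part of real
  weight at most \<open>n\<close> is finite-dimensional. Hence every such module is isomorphic to one carried by
  a subspace of \<^typ>\<open>nat \<Rightarrow> complex\<close>, and this ambient type loses no generality in
  existence statements.
\<close>

type_synonym 'v countable_vmod = "('v, nat \<Rightarrow> complex) vmod"

end

theory Submission
  imports Defs "HOL-Library.Countable" "HOL-Computational_Algebra.Formal_Power_Series"
begin

text \<open>
  Fix $p, q\in\mathfrak h$ with $\langle p,q\rangle = 1$ and let \<open>h\<close> be the state of \<open>p\<close>. All zero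
  modes vanish on $SF_d$, but that of \<open>q\<close> can be deformed to a nonzero nilpotent operator: with an odd
  parameter $\theta$, $\theta^2=0$, Li's operator
  $\Delta(z)=\exp(\theta\sum_{k\ge1}\frac{(-1)^{k+1}}{k}h_kz^{-k})$ makes $SF_d\oplus\theta SF_d$ a module
  under $Y(\Delta(z)u,z)$, on which $a(z)$ acts as $a(z)+\theta\langle p,a\rangle z^{-1}$.
  The Jacobi identity for the terms of order $\theta$ comes from the commutator formula for $h_k$ and
  the Chu-Vandermonde convolution. The operator $L(0)$ is not deformed, so the module lies in
  $\mathrm{Mod}(SF_d^+)$.
  If $x+\theta y$ is in $\Omega$, then all products $a_kb_n$ with $k+n>0$ kill it; for $b=q$, $n=0$
  this says $a_kx=0$ for all $k\ge1$. Then $L(0)x=0$, so \<open>x\<close> is a multiple of the vacuum and in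
  particular even, and the vectors $x+\theta y$ with \<open>x\<close> even form a proper submodule.
\<close>

subsection \<open>Binomial convolutions\<close>

lemma Sum_any_eq_sum_atMost:
  assumes "\<And>i. i > N \<Longrightarrow> g i = 0"
  shows "Sum_any g = sum g {..N::nat}"
  by (rule Sum_any.expand_superset) (use assms in \<open>force simp: not_le[symmetric]\<close>)+

text \<open>Only the finitely many \<open>k\<close> up to \<open>K\<close> constrain the bound, so a
  single \<open>N\<close> works for the whole family. This truncates the modes of all states h_k u
  at once, because h_k u = 0 for large k.\<close>

lemma eventually_family:
  assumes "\<And>k. eventually (P k) sequentially" and "\<And>k N. k > K \<Longrightarrow> P k N"
  shows "\<forall>\<^sub>F N in sequentially. \<forall>k::nat. P k N"
proof -
  have "\<forall>\<^sub>F N in sequentially. \<forall>k\<in>{..K}. P k N"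
    using assms(1) by (simp add: eventually_ball_finite_distrib)
  then show ?thesis
    by eventually_elim (use assms(2) in \<open>force simp: not_le[symmetric]\<close>)
qed

text \<open>At \<open>k = 0\<close> the value is \<open>0\<close> because of division by zero; for \<open>k \<ge> 1\<close> this is the
  derivative of \<open>m gchoose k\<close> with respect to \<open>m\<close> at \<open>m = 0\<close>.\<close>

definition log_coeff :: "nat \<Rightarrow> complex" where
  "log_coeff k = (-1) ^ (k + 1) / of_nat k"

lemma log_coeff_0 [simp]: "log_coeff 0 = 0"
  by (simp add: log_coeff_def)

text \<open>By absorption binom(j+t, j)/(j+t) = binom(j+t-1, t)/j, and binom(-j, t) = (-1)^t
  binom(j+t-1, t) by negation of the upper index.\<close>

lemma log_coeff_mult_binomial:
  assumes "j \<ge> 1"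
  shows "log_coeff (j + t) * of_nat ((j + t) choose j) = log_coeff j * ((- of_nat j) gchoose t)"
proof -
  obtain i where j: "j = Suc i" using assms by (cases j) auto
  have "j * ((j + t) choose j) = (j + t) * ((i + t) choose i)"
    using Suc_times_binomial_eq[of "i + t" i] by (simp add: j mult.commute)
  then have A: "complex_of_nat j * of_nat ((j + t) choose j) = of_nat (j + t) * of_nat ((i + t) choose i)"
    by (metis of_nat_mult)
  have "(- complex_of_nat j) gchoose t = (-1) ^ t * (complex_of_nat (i + t) gchoose t)"
    by (subst gbinomial_minus) (simp add: j add_ac)
  also have "\<dots> = (-1) ^ t * of_nat ((i + t) choose i)"
    using binomial_symmetric[of i "i + t"] by (simp add: binomial_gbinomial)
  finally have B: "(- complex_of_nat j) gchoose t = (-1) ^ t * of_nat ((i + t) choose i)" .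
  have "complex_of_nat j \<noteq> 0" "complex_of_nat (j + t) \<noteq> 0"
    using assms by (auto simp del: of_nat_add)
  moreover have "complex_of_nat ((j + t) choose j)
      = of_nat (j + t) * of_nat ((i + t) choose i) / of_nat j"
    using A calculation by (simp add: field_simps del: of_nat_add)
  ultimately show ?thesis
    unfolding log_coeff_def B by (simp add: field_simps power_add del: of_nat_add)
qed

text \<open>Chu-Vandermonde after grouping by s = i + t; pairs in the square with i + t > N
  contribute nothing because \<open>g\<close> vanishes there.\<close>

lemma sum_scale_gchoose_convolution:
  fixes sc :: "complex \<Rightarrow> 'v::ab_group_add \<Rightarrow> 'v" and g :: "nat \<Rightarrow> 'v"
  assumes "module sc" and g: "\<And>s. s > N \<Longrightarrow> g s = 0"
  shows "(\<Sum>i\<le>N. \<Sum>t\<le>N. sc ((a gchoose i) * (b gchoose t)) (g (i + t)))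
    = (\<Sum>s\<le>N. sc ((a + b) gchoose s) (g s))"
proof -
  interpret m: module sc by fact
  have "(\<Sum>i\<le>N. \<Sum>t\<le>N. sc ((a gchoose i) * (b gchoose t)) (g (i + t)))
      = (\<Sum>(i, t)\<in>{..N} \<times> {..N}. sc ((a gchoose i) * (b gchoose t)) (g (i + t)))"
    by (rule sum.cartesian_product)
  also have "\<dots> = (\<Sum>(i, t)\<in>{(i, t). i + t \<le> N}. sc ((a gchoose i) * (b gchoose t)) (g (i + t)))"
    by (rule sum.mono_neutral_right) (auto, metis g m.scale_zero_right not_le)
  also have "\<dots> = (\<Sum>s\<le>N. \<Sum>i\<le>s. sc ((a gchoose i) * (b gchoose (s - i))) (g (i + (s - i))))"
    by (rule sum.triangle_reindex_eq)
  also have "\<dots> = (\<Sum>s\<le>N. \<Sum>i\<le>s. sc ((a gchoose i) * (b gchoose (s - i))) (g s))"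
    by (intro sum.cong) auto
  also have "\<dots> = (\<Sum>s\<le>N. sc ((a + b) gchoose s) (g s))"
    by (simp add: m.scale_sum_left[symmetric] gbinomial_Vandermonde[symmetric] atMost_atLeast0)
  finally show ?thesis .
qed

text \<open>With t = k - j, \<open>log_coeff_mult_binomial\<close> turns the weights into binomials
  with upper index -j, and convolution with those of \<open>a\<close> gives upper index a - j. In
  this way the commutators of h_k with u_{l+i} will assemble to Jacobi identities at m - j.\<close>

lemma sum_log_coeff_reindex:
  fixes sc :: "complex \<Rightarrow> 'v::ab_group_add \<Rightarrow> 'v" and G :: "nat \<Rightarrow> nat \<Rightarrow> 'v"
  assumes "module sc"
    and G: "\<And>j s. j > N \<Longrightarrow> G j s = 0" "\<And>j s. s > N \<Longrightarrow> G j s = 0" "\<And>s. G 0 s = 0"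
  shows "(\<Sum>i\<le>N. sc (a gchoose i) (\<Sum>k\<le>2 * N. sc (log_coeff k)
      (\<Sum>j\<le>k. sc (of_nat (k choose j)) (G j (i + (k - j))))))
    = (\<Sum>j\<le>N. sc (log_coeff j) (\<Sum>s\<le>N. sc ((a - of_nat j) gchoose s) (G j s)))"
proof -
  interpret m: module sc by fact
  have inner: "(\<Sum>k\<le>2 * N. sc (log_coeff k) (\<Sum>j\<le>k. sc (of_nat (k choose j)) (G j (i + (k - j)))))
      = (\<Sum>j\<le>N. \<Sum>t\<le>N. sc (log_coeff j * ((- of_nat j) gchoose t)) (G j (i + t)))" for i
  proof -
    let ?h = "\<lambda>j t. sc (log_coeff (j + t) * of_nat ((j + t) choose j)) (G j (i + t))"
    have "(\<Sum>k\<le>2 * N. sc (log_coeff k) (\<Sum>j\<le>k. sc (of_nat (k choose j)) (G j (i + (k - j)))))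
        = (\<Sum>k\<le>2 * N. \<Sum>j\<le>k. ?h j (k - j))"
      by (simp add: m.scale_sum_right)
    also have "\<dots> = (\<Sum>(j, t)\<in>{(j, t). j + t \<le> 2 * N}. ?h j t)"
      by (rule sum.triangle_reindex_eq[symmetric])
    \<comment> \<open>The range up to \<open>2 * N\<close> contains every pair with j, t \<le> N;
      any other pair has j > N or i + t > N.\<close>
    also have "\<dots> = (\<Sum>(j, t)\<in>{..N} \<times> {..N}. ?h j t)"
    proof (rule sum.mono_neutral_right)
      have "{(j, t). j + t \<le> 2 * N} \<subseteq> {..2 * N} \<times> {..2 * N}" by auto
      then show "finite {(j, t). j + t \<le> 2 * N}" using finite_subset by blast
    qed (auto, (metis G(1,2) m.scale_zero_right not_le trans_less_add2)+)
    also have "\<dots> = (\<Sum>j\<le>N. \<Sum>t\<le>N. ?h j t)"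
      by (rule sum.cartesian_product[symmetric])
    also have "\<dots> = (\<Sum>j\<le>N. \<Sum>t\<le>N. sc (log_coeff j * ((- of_nat j) gchoose t)) (G j (i + t)))"
    proof (intro sum.cong refl)
      fix j t
      \<comment> \<open>For j = 0 the coefficients differ: \<open>log_coeff t\<close> on the left, 0
        on the right. The vanishing of \<open>G 0\<close>, later supplied by the zero mode of
        \<open>h\<close>, closes this case.\<close>
      show "?h j t = sc (log_coeff j * ((- of_nat j) gchoose t)) (G j (i + t))"
        by (cases "j = 0") (use log_coeff_mult_binomial[of j t] G(3) in auto)
    qed
    finally show ?thesis .
  qed
  have "(\<Sum>i\<le>N. sc (a gchoose i) (\<Sum>k\<le>2 * N. sc (log_coeff k)
      (\<Sum>j\<le>k. sc (of_nat (k choose j)) (G j (i + (k - j))))))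
    = (\<Sum>i\<le>N. \<Sum>j\<le>N. \<Sum>t\<le>N. sc (log_coeff j) (sc ((a gchoose i) * ((- of_nat j) gchoose t)) (G j (i + t))))"
    unfolding inner by (simp add: m.scale_sum_right mult_ac)
  also have "\<dots> = (\<Sum>j\<le>N. sc (log_coeff j) (\<Sum>i\<le>N. \<Sum>t\<le>N. sc ((a gchoose i) * ((- of_nat j) gchoose t)) (G j (i + t))))"
    unfolding m.scale_sum_right by (rule sum.swap)
  also have "\<dots> = (\<Sum>j\<le>N. sc (log_coeff j) (\<Sum>s\<le>N. sc ((a - of_nat j) gchoose s) (G j s)))"
    using sum_scale_gchoose_convolution[OF \<open>module sc\<close>, of N "G _" a "- of_nat _"] G(2) by simp
  finally show ?thesis .
qed

subsection \<open>Modes of vertex superalgebras\<close>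

context vertex_superalgebra
begin

sublocale vs: vector_space "vscale V"
  by (rule vector_space)

lemma parity_carrier: "p < 2 \<Longrightarrow> u \<in> parity V p \<Longrightarrow> u \<in> vcarrier V"
  using parity_sum vs.subspace_0[OF parity_subspace[of 0]] vs.subspace_0[OF parity_subspace[of 1]]
  by (auto simp: less_2_cases_iff) (metis add.right_neutral, metis add.left_neutral)

lemma carrier_subspace: "vs.subspace (vcarrier V)"
  using vs.subspace_sums[OF parity_subspace[of 0] parity_subspace[of 1]] by (simp add: parity_sum)

lemmas carrier_closed [simp, intro] =
  vs.subspace_0[OF carrier_subspace] vs.subspace_add[OF carrier_subspace]
  vs.subspace_scale[OF carrier_subspace] vs.subspace_diff[OF carrier_subspace]
  vs.subspace_neg[OF carrier_subspace] vs.subspace_sum[OF carrier_subspace]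

lemma vac_carrier [simp, intro]: "vac V \<in> vcarrier V"
  using parity_carrier[OF _ vac_even] by simp

lemma mode_closed [simp, intro]:
  assumes "u \<in> vcarrier V" "v \<in> vcarrier V"
  shows "Y V u n v \<in> vcarrier V"
proof -
  obtain u0 u1 v0 v1 where *: "u = u0 + u1" "v = v0 + v1" "u0 \<in> parity V 0" "u1 \<in> parity V 1"
    "v0 \<in> parity V 0" "v1 \<in> parity V 1"
    using assms by (auto simp: parity_sum)
  then have C: "u0 \<in> vcarrier V" "u1 \<in> vcarrier V" "v0 \<in> vcarrier V" "v1 \<in> vcarrier V"
    using parity_carrier[of 0] parity_carrier[of 1] by auto
  have "Y V a n b \<in> vcarrier V" if "a \<in> parity V p" "b \<in> parity V q" "p < 2" "q < 2" for a b p q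
    using mode_parity[OF that(3,4,1,2)] parity_carrier[of "(p + q) mod 2"] by simp
  then show ?thesis
    using * C by (simp add: mode_add_left mode_add_right)
qed

lemma mode_zero_left [simp]: "v \<in> vcarrier V \<Longrightarrow> Y V 0 n v = 0"
  using mode_scale_left[of 0 v 0 n] by simp

lemma mode_zero_right [simp]: "u \<in> vcarrier V \<Longrightarrow> Y V u n 0 = 0"
  using mode_scale_right[of u 0 n 0] by simp

lemma mode_sum_left:
  "(\<And>i. i \<in> I \<Longrightarrow> g i \<in> vcarrier V) \<Longrightarrow> v \<in> vcarrier V
    \<Longrightarrow> Y V (sum g I) n v = (\<Sum>i\<in>I. Y V (g i) n v)"
  by (induction I rule: infinite_finite_induct) (auto simp: mode_add_left)

lemma mode_sum_right:
  "(\<And>i. i \<in> I \<Longrightarrow> g i \<in> vcarrier V) \<Longrightarrow> u \<in> vcarrier V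
    \<Longrightarrow> Y V u n (sum g I) = (\<Sum>i\<in>I. Y V u n (g i))"
  by (induction I rule: infinite_finite_induct) (auto simp: mode_add_right)

lemma mode_eventually_zero:
  assumes "u \<in> vcarrier V" "v \<in> vcarrier V"
  shows "\<forall>\<^sub>F N in sequentially. \<forall>i>N. Y V u (a + int i) v = 0"
proof -
  obtain N where N: "\<forall>n\<ge>N. Y V u n v = 0" using truncation assms by blast
  show ?thesis
    unfolding eventually_sequentially
    by (rule exI[of _ "nat (N - a)"]) (auto intro!: N[rule_format])
qed

text \<open>A common truncation bound puts both sides over the same finite range, so that instances
  can be combined linearly and sums interchanged.\<close>

lemma jacobi_finite:
  assumes "p < 2" "q < 2" "u \<in> parity V p" "v \<in> parity V q" "w \<in> vcarrier V"
    and "\<And>i. i > N \<Longrightarrow> Y V u (l + int i) v = 0"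
    and "\<And>i. i > N \<Longrightarrow> Y V v (n + int i) w = 0"
    and "\<And>i. i > N \<Longrightarrow> Y V u (m + int i) w = 0"
  shows "(\<Sum>i\<le>N. vscale V (of_int m gchoose i) (Y V (Y V u (l + int i) v) (m + n - int i) w))
    = (\<Sum>i\<le>N. vscale V ((-1) ^ i * (of_int l gchoose i))
        (Y V u (l + m - int i) (Y V v (n + int i) w)
         - vscale V ((-1) ^ (p * q) * (-1) powi l) (Y V v (l + n - int i) (Y V u (m + int i) w))))"
proof -
  have C: "u \<in> vcarrier V" "v \<in> vcarrier V" using assms parity_carrier by auto
  show ?thesis
    using jacobi[OF assms(1-5), unfolded jacobi_def, rule_format, of m l n]
    by (subst (asm) (1 2) Sum_any_eq_sum_atMost[where N = N]) (auto simp: assms C)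
qed

text \<open>The Jacobi identity at l = 0: on the right only i = 0 survives, and on the left the
  binomials of the natural number m vanish beyond m.\<close>

lemma commutator_formula:
  assumes p: "p < 2" "q < 2" "u \<in> parity V p" "v \<in> parity V q" "w \<in> vcarrier V"
  shows "Y V u (int m) (Y V v n w) = vscale V ((-1) ^ (p * q)) (Y V v n (Y V u (int m) w))
    + (\<Sum>j\<le>m. vscale V (of_nat (m choose j)) (Y V (Y V u (int j) v) (int m + n - int j) w))"
proof -
  have C: "u \<in> vcarrier V" "v \<in> vcarrier V" using p parity_carrier by auto
  have "\<forall>\<^sub>F N in sequentially. N \<ge> m \<and> (\<forall>i>N. Y V u (0 + int i) v = 0) \<and>
    (\<forall>i>N. Y V v (n + int i) w = 0) \<and> (\<forall>i>N. Y V u (int m + int i) w = 0)"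
    by (intro eventually_conj mode_eventually_zero C p eventually_ge_at_top)
  then obtain N where N: "N \<ge> m" "\<And>i. i > N \<Longrightarrow> Y V u (0 + int i) v = 0"
    "\<And>i. i > N \<Longrightarrow> Y V v (n + int i) w = 0" "\<And>i. i > N \<Longrightarrow> Y V u (int m + int i) w = 0"
    unfolding eventually_sequentially by (meson order_refl)
  have R: "(\<Sum>i\<le>N. vscale V ((-1) ^ i * (0 gchoose i)) (g i)) = g 0" for g :: "nat \<Rightarrow> 'v"
  proof -
    have "(\<Sum>i\<le>N. vscale V ((-1) ^ i * (0 gchoose i)) (g i)) = (\<Sum>i\<in>{0}. vscale V ((-1) ^ i * (0 gchoose i)) (g i))"
      by (rule sum.mono_neutral_right) (auto simp: gbinomial_0_left)
    then show ?thesis by simp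
  qed
  have Lh: "(\<Sum>i\<le>N. vscale V (of_int (int m) gchoose i) (g i))
      = (\<Sum>j\<le>m. vscale V (of_nat (m choose j)) (g j))" for g :: "nat \<Rightarrow> 'v"
  proof -
    have "(\<Sum>i\<le>N. vscale V (of_int (int m) gchoose i) (g i)) = (\<Sum>i\<le>N. vscale V (of_nat (m choose i)) (g i))"
      by (simp add: binomial_gbinomial)
    also have "\<dots> = (\<Sum>j\<le>m. vscale V (of_nat (m choose j)) (g j))"
      by (rule sum.mono_neutral_right) (use N(1) in \<open>auto simp: not_le\<close>)
    finally show ?thesis .
  qed
  have "(\<Sum>i\<le>N. vscale V (of_int (int m) gchoose i) (Y V (Y V u (0 + int i) v) (int m + n - int i) w))
    = (\<Sum>i\<le>N. vscale V ((-1) ^ i * (of_int 0 gchoose i))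
        (Y V u (0 + int m - int i) (Y V v (n + int i) w)
         - vscale V ((-1) ^ (p * q) * (-1) powi 0) (Y V v (0 + n - int i) (Y V u (int m + int i) w))))"
    by (rule jacobi_finite[OF p N(2-4)])
  then show ?thesis
    unfolding Lh of_int_0 R by (simp add: algebra_simps)
qed

end

subsection \<open>Deformation by an odd state with vanishing zero mode\<close>

text \<open>Li's operator also has a factor z^{h_0}; for a nilpotent parameter it would contribute
  h_0 log z. A vanishing zero mode excludes logarithms and leaves only integral powers of z.\<close>

locale odd_deformation = vertex_superalgebra V
  for V :: "('v::ab_group_add) vosa" +
  fixes h :: 'v
  assumes h_odd: "h \<in> parity V 1"
    and h_zero_mode: "v \<in> vcarrier V \<Longrightarrow> Y V h 0 v = 0"
begin

text \<open>The coefficient of $\theta z^{-m-1}$ in $Y(\Delta(z)u,z)x$.\<close>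

definition deform :: "'v \<Rightarrow> int \<Rightarrow> 'v \<Rightarrow> 'v" where
  "deform u m x = Sum_any (\<lambda>k. vscale V (log_coeff k) (Y V (Y V h (int k) u) (m - int k) x))"

lemma h_carrier [simp, intro]: "h \<in> vcarrier V"
  using parity_carrier[of 1] h_odd by simp

lemma h_mode_parity: "p < 2 \<Longrightarrow> u \<in> parity V p \<Longrightarrow> Y V h n u \<in> parity V ((1 + p) mod 2)"
  using mode_parity[of 1 p h u n] h_odd by simp

lemma deform_eq:
  assumes "\<And>k. k > N \<Longrightarrow> Y V h (int k) u = 0" and "x \<in> vcarrier V"
  shows "deform u m x = (\<Sum>k\<le>N. vscale V (log_coeff k) (Y V (Y V h (int k) u) (m - int k) x))"
  unfolding deform_def by (rule Sum_any_eq_sum_atMost) (simp add: assms)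

lemma h_eventually: "u \<in> vcarrier V \<Longrightarrow> \<forall>\<^sub>F N in sequentially. \<forall>k>N. Y V h (int k) u = 0"
  using mode_eventually_zero[of h u 0] by simp

lemma h_truncation:
  assumes "u \<in> vcarrier V"
  obtains N where "\<And>k. k > N \<Longrightarrow> Y V h (int k) u = 0"
  using h_eventually[OF assms] unfolding eventually_sequentially by (meson order_refl)

lemma deform_closed [simp, intro]:
  assumes "u \<in> vcarrier V" "x \<in> vcarrier V"
  shows "deform u m x \<in> vcarrier V"
proof -
  obtain N where "\<And>k. k > N \<Longrightarrow> Y V h (int k) u = 0" using h_truncation assms by blast
  then show ?thesis by (subst deform_eq[of N]) (auto simp: assms)
qed

lemma deform_add_left:
  assumes C: "u \<in> vcarrier V" "v \<in> vcarrier V" "x \<in> vcarrier V"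
  shows "deform (u + v) m x = deform u m x + deform v m x"
proof -
  have "\<forall>\<^sub>F N in sequentially. (\<forall>k>N. Y V h (int k) u = 0) \<and> (\<forall>k>N. Y V h (int k) v = 0)"
    by (intro eventually_conj h_eventually C)
  then obtain N where "\<And>k. k > N \<Longrightarrow> Y V h (int k) u = 0" "\<And>k. k > N \<Longrightarrow> Y V h (int k) v = 0"
    unfolding eventually_sequentially by (meson order_refl)
  then show ?thesis
    by (subst (1 2 3) deform_eq[of N])
      (auto simp: C mode_add_left mode_add_right vs.scale_right_distrib sum.distrib)
qed

lemma deform_scale_left:
  assumes C: "u \<in> vcarrier V" "x \<in> vcarrier V"
  shows "deform (vscale V c u) m x = vscale V c (deform u m x)"
proof -
  obtain N where "\<And>k. k > N \<Longrightarrow> Y V h (int k) u = 0" using h_truncation C by blast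
  then show ?thesis
    by (subst (1 2) deform_eq[of N])
      (auto simp: C mode_scale_left mode_scale_right vs.scale_sum_right mult_ac)
qed

lemma deform_add_right:
  assumes C: "u \<in> vcarrier V" "x \<in> vcarrier V" "y \<in> vcarrier V"
  shows "deform u m (x + y) = deform u m x + deform u m y"
proof -
  obtain N where "\<And>k. k > N \<Longrightarrow> Y V h (int k) u = 0" using h_truncation C by blast
  then show ?thesis
    by (subst (1 2 3) deform_eq[of N])
      (auto simp: C mode_add_right vs.scale_right_distrib sum.distrib)
qed

lemma deform_scale_right:
  assumes C: "u \<in> vcarrier V" "x \<in> vcarrier V"
  shows "deform u m (vscale V c x) = vscale V c (deform u m x)"
proof -
  obtain N where "\<And>k. k > N \<Longrightarrow> Y V h (int k) u = 0" using h_truncation C by blast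
  then show ?thesis
    by (subst (1 2) deform_eq[of N])
      (auto simp: C mode_scale_right vs.scale_sum_right mult_ac)
qed

lemma deform_zero_left [simp]: "x \<in> vcarrier V \<Longrightarrow> deform 0 m x = 0"
  using deform_scale_left[where u = 0 and c = 0] by simp

lemma deform_zero_right [simp]: "u \<in> vcarrier V \<Longrightarrow> deform u m 0 = 0"
  using deform_scale_right[where x = 0 and c = 0] by simp

lemma deform_vac [simp]: "x \<in> vcarrier V \<Longrightarrow> deform (vac V) m x = 0"
  by (subst deform_eq[of 0]) (auto simp: creation)

lemma h_family_truncation:
  assumes "u \<in> vcarrier V" "v \<in> vcarrier V"
  shows "\<forall>\<^sub>F N in sequentially. \<forall>k i. i > N \<longrightarrow> Y V (Y V h (int k) u) (a k + int i) v = 0"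
    and "\<forall>\<^sub>F N in sequentially. \<forall>k i. i > N \<longrightarrow> Y V v (a k + int i) (Y V h (int k) u) = 0"
proof -
  obtain K where K: "\<And>k. k > K \<Longrightarrow> Y V h (int k) u = 0" using h_truncation assms by blast
  show "\<forall>\<^sub>F N in sequentially. \<forall>k i. i > N \<longrightarrow> Y V (Y V h (int k) u) (a k + int i) v = 0"
    by (rule eventually_family[of _ K]) (use mode_eventually_zero assms K in auto)
  show "\<forall>\<^sub>F N in sequentially. \<forall>k i. i > N \<longrightarrow> Y V v (a k + int i) (Y V h (int k) u) = 0"
    by (rule eventually_family[of _ K]) (use mode_eventually_zero assms K in auto)
qed

lemma deform_eventually_zero:
  assumes "u \<in> vcarrier V" "x \<in> vcarrier V"
  shows "\<forall>\<^sub>F N in sequentially. \<forall>i>N. deform u (a + int i) x = 0"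
  using h_family_truncation(1)[OF assms, of "\<lambda>k. a - int k"]
proof eventually_elim
  case (elim N)
  then show ?case
    by (auto simp: deform_def algebra_simps)
qed

text \<open>The coefficient of \<theta> in the Jacobi identity for the modes \<open>Y V u m\<close>
  + \<theta> \<open>deform u m\<close>; the signs (-1)^p and (-1)^q come from moving \<theta> to the
  left past u and v. It is a combination, with weights \<open>log_coeff k\<close>, of the identities
  for (h_k u, v) and (u, h_k v), whose left-hand sides recombine through the commutator of h_k with
  u_{l+i}.\<close>

lemma deform_jacobi:
  assumes p: "p < 2" "q < 2" "u \<in> parity V p" "v \<in> parity V q" "x \<in> vcarrier V"
  shows "\<forall>\<^sub>F N in sequentially.
    (\<Sum>i\<le>N. vscale V (of_int m gchoose i) (deform (Y V u (l + int i) v) (m + n - int i) x))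
    = (\<Sum>i\<le>N. vscale V ((-1) ^ i * (of_int l gchoose i))
        (deform u (l + m - int i) (Y V v (n + int i) x)
         + vscale V ((-1) ^ p) (Y V u (l + m - int i) (deform v (n + int i) x))
         - vscale V ((-1) ^ (p * q) * (-1) powi l)
            (deform v (l + n - int i) (Y V u (m + int i) x)
             + vscale V ((-1) ^ q) (Y V v (l + n - int i) (deform u (m + int i) x)))))"
proof -
  let ?s = "vscale V"
  let ?H = "\<lambda>k. Y V h (int k)"
  have C [simp, intro]: "u \<in> vcarrier V" "v \<in> vcarrier V" "x \<in> vcarrier V"
    using p parity_carrier by auto
  have "\<forall>\<^sub>F N in sequentially. (\<forall>k>N. ?H k u = 0) \<and> (\<forall>k>N. ?H k v = 0)
    \<and> (\<forall>i>N. Y V u (l + int i) v = 0) \<and> (\<forall>i>N. Y V v (n + int i) x = 0)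
    \<and> (\<forall>i>N. Y V u (m + int i) x = 0)
    \<and> (\<forall>k i. i > N \<longrightarrow> Y V (?H k u) (l + int i) v = 0)
    \<and> (\<forall>k i. i > N \<longrightarrow> Y V u (l + int i) (?H k v) = 0)
    \<and> (\<forall>k i. i > N \<longrightarrow> Y V (?H k u) (m - int k + int i) x = 0)
    \<and> (\<forall>k i. i > N \<longrightarrow> Y V (?H k v) (n - int k + int i) x = 0)"
    by (intro eventually_conj h_eventually mode_eventually_zero h_family_truncation C)
  then show ?thesis
  proof eventually_elim
    case (elim N)
    then have t: "\<And>k. k > N \<Longrightarrow> ?H k u = 0" "\<And>k. k > N \<Longrightarrow> ?H k v = 0"
      "\<And>i. i > N \<Longrightarrow> Y V u (l + int i) v = 0" "\<And>i. i > N \<Longrightarrow> Y V v (n + int i) x = 0"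
      "\<And>i. i > N \<Longrightarrow> Y V u (m + int i) x = 0"
      "\<And>k i. i > N \<Longrightarrow> Y V (?H k u) (l + int i) v = 0"
      "\<And>k i. i > N \<Longrightarrow> Y V u (l + int i) (?H k v) = 0"
      "\<And>k i. i > N \<Longrightarrow> Y V (?H k u) (m - int k + int i) x = 0"
      "\<And>k i. i > N \<Longrightarrow> Y V (?H k v) (n - int k + int i) x = 0"
      by blast+
    have t': "Y V (?H k u) (m + int i - int k) x = 0" "Y V (?H k v) (n + int i - int k) x = 0"
      if "i > N" for k i
      using t(8,9)[OF that, of k] by (simp_all add: algebra_simps)
    \<comment> \<open>\<open>G\<close>, \<open>R1\<close> are the left and right terms of the Jacobi
      identity for (h_k u, v) with m - k in place of m; \<open>G'\<close>, \<open>R2\<close> are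
      those for (u, h_k v) with n - k in place of n.\<close>
    define G where "G j s = Y V (Y V (?H j u) (l + int s) v) (m + n - int j - int s) x" for j s
    define G' where "G' k i = Y V (Y V u (l + int i) (?H k v)) (m + n - int k - int i) x" for k i
    define R1 where "R1 k i = Y V (?H k u) (l + (m - int k) - int i) (Y V v (n + int i) x)
         - ?s ((-1) ^ (((1 + p) mod 2) * q) * (-1) powi l)
            (Y V v (l + n - int i) (Y V (?H k u) (m - int k + int i) x))" for k i
    define R2 where "R2 k i = Y V u (l + m - int i) (Y V (?H k v) (n - int k + int i) x)
         - ?s ((-1) ^ (p * ((1 + q) mod 2)) * (-1) powi l)
            (Y V (?H k v) (l + (n - int k) - int i) (Y V u (m + int i) x))" for k i
    have J1: "(\<Sum>s\<le>N. ?s ((of_int m - of_nat k) gchoose s) (G k s))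
        = (\<Sum>i\<le>N. ?s ((-1) ^ i * (of_int l gchoose i)) (R1 k i))" for k
      using jacobi_finite[OF _ p(2) h_mode_parity[OF p(1,3), of "int k"] p(4,5), of N l n "m - int k"]
      by (simp add: t t' G_def R1_def algebra_simps)
    have J2: "(\<Sum>s\<le>N. ?s (of_int m gchoose s) (G' k s))
        = (\<Sum>i\<le>N. ?s ((-1) ^ i * (of_int l gchoose i)) (R2 k i))" for k
      using jacobi_finite[OF p(1) _ p(3) h_mode_parity[OF p(2,4), of "int k"] p(5), of N l "n - int k" m]
      by (simp add: t t' G'_def R2_def algebra_simps)
    have G0: "G j s = 0" if "j > N \<or> s > N \<or> j = 0" for j s
      using that t(1,6) by (auto simp: G_def h_zero_mode)
    have G'0: "G' k i = 0" if "k > N" for k i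
      using that t(2) by (auto simp: G'_def)
    \<comment> \<open>For fixed j the mode depends on i and k only through i + (k - j), the shape
      required by \<open>sum_log_coeff_reindex\<close>.\<close>
    have comm: "?H k (Y V u (l + int i) v) = ?s ((-1) ^ p) (Y V u (l + int i) (?H k v))
      + (\<Sum>j\<le>k. ?s (of_nat (k choose j)) (Y V (?H j u) (l + int (i + (k - j))) v))" for k i
    proof -
      have "?H k (Y V u (l + int i) v) = ?s ((-1) ^ p) (Y V u (l + int i) (?H k v))
        + (\<Sum>j\<le>k. ?s (of_nat (k choose j)) (Y V (?H j u) (int k + (l + int i) - int j) v))"
        using commutator_formula[of 1 p h u v k "l + int i"] p h_odd by simp
      also have "(\<Sum>j\<le>k. ?s (of_nat (k choose j)) (Y V (?H j u) (int k + (l + int i) - int j) v))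
        = (\<Sum>j\<le>k. ?s (of_nat (k choose j)) (Y V (?H j u) (l + int (i + (k - j))) v))"
        by (intro sum.cong refl arg_cong2[where f = ?s] arg_cong[where f = "\<lambda>z. Y V _ z v"]) auto
      finally show ?thesis .
    qed
    have dl: "deform (Y V u (l + int i) v) (m + n - int i) x
        = ?s ((-1) ^ p) (\<Sum>k\<le>N. ?s (log_coeff k) (G' k i))
        + (\<Sum>k\<le>2 * N. ?s (log_coeff k) (\<Sum>j\<le>k. ?s (of_nat (k choose j)) (G j (i + (k - j)))))" for i
    proof -
      \<comment> \<open>If k > 2N, then each j \<le> k has j > N, where h_j u = 0, or k - j > N,
        where the mode vanishes.\<close>
      have van: "?H k (Y V u (l + int i) v) = 0" if "k > 2 * N" for k
      proof -
        have "Y V (?H j u) (l + int (i + (k - j))) v = 0" if "j \<le> k" for j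
          using t(1)[of j] t(6)[of "i + (k - j)" j] that \<open>k > 2 * N\<close> by (cases "j > N") auto
        then show ?thesis
          unfolding comm using t(2)[of k] that by simp
      qed
      have "deform (Y V u (l + int i) v) (m + n - int i) x
        = (\<Sum>k\<le>2 * N. ?s (log_coeff k) (Y V (?H k (Y V u (l + int i) v)) (m + n - int i - int k) x))"
        by (rule deform_eq) (use van in auto)
      also have "\<dots> = (\<Sum>k\<le>2 * N. ?s (log_coeff k) (?s ((-1) ^ p) (G' k i)
          + (\<Sum>j\<le>k. ?s (of_nat (k choose j)) (G j (i + (k - j))))))"
      proof (intro sum.cong refl arg_cong2[where f = ?s])
        fix k
        have "Y V (Y V (?H j u) (l + int (i + (k - j))) v) (m + n - int i - int k) x
          = G j (i + (k - j))" if "j \<le> k" for j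
          using that by (simp add: G_def of_nat_diff algebra_simps)
        then show "Y V (?H k (Y V u (l + int i) v)) (m + n - int i - int k) x = ?s ((-1) ^ p) (G' k i)
          + (\<Sum>j\<le>k. ?s (of_nat (k choose j)) (G j (i + (k - j))))"
          unfolding comm
          by (simp add: mode_add_left mode_sum_left mode_scale_left carrier_closed G'_def algebra_simps)
      qed
      also have "\<dots> = (\<Sum>k\<le>2 * N. ?s ((-1) ^ p) (?s (log_coeff k) (G' k i)))
          + (\<Sum>k\<le>2 * N. ?s (log_coeff k) (\<Sum>j\<le>k. ?s (of_nat (k choose j)) (G j (i + (k - j)))))"
        by (simp add: vs.scale_right_distrib sum.distrib mult_ac)
      also have "(\<Sum>k\<le>2 * N. ?s ((-1) ^ p) (?s (log_coeff k) (G' k i)))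
          = (\<Sum>k\<le>N. ?s ((-1) ^ p) (?s (log_coeff k) (G' k i)))"
        by (rule sum.mono_neutral_right) (auto simp: G'0)
      finally show ?thesis by (simp only: vs.scale_sum_right)
    qed
    have dr: "deform u (l + m - int i) (Y V v (n + int i) x)
         + ?s ((-1) ^ p) (Y V u (l + m - int i) (deform v (n + int i) x))
         - ?s ((-1) ^ (p * q) * (-1) powi l)
            (deform v (l + n - int i) (Y V u (m + int i) x)
             + ?s ((-1) ^ q) (Y V v (l + n - int i) (deform u (m + int i) x)))
        = (\<Sum>k\<le>N. ?s (log_coeff k) (R1 k i + ?s ((-1) ^ p) (R2 k i)))" for i
    proof -
      have sg: "p = 0 \<or> p = 1" "q = 0 \<or> q = 1" using p(1,2) by auto
      \<comment> \<open>Since h_k changes parity, exchanging h_k u with v costs an extra (-1)^q, and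
        exchanging u with h_k v an extra (-1)^p, which cancels the prefactor of \<open>R2\<close>.
        Both families thus share the factor (-1)^{pq}.\<close>
      have s1: "(-1) ^ (((1 + p) mod 2) * q) = (-1) ^ (p * q) * (-1::complex) ^ q"
        and s2: "(-1) ^ p * (-1) ^ (p * ((1 + q) mod 2)) = (-1::complex) ^ (p * q)"
        using sg by auto
      have e: "deform u k z = (\<Sum>j\<le>N. ?s (log_coeff j) (Y V (?H j u) (k - int j) z))"
        "deform v k z = (\<Sum>j\<le>N. ?s (log_coeff j) (Y V (?H j v) (k - int j) z))"
        if "z \<in> vcarrier V" for k z
        using deform_eq t(1,2) that by auto
      have "?s (log_coeff k) (R1 k i + ?s ((-1) ^ p) (R2 k i))
        = ?s (log_coeff k) (Y V (?H k u) (l + m - int i - int k) (Y V v (n + int i) x))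
          + ?s ((-1) ^ p) (?s (log_coeff k) (Y V u (l + m - int i) (Y V (?H k v) (n + int i - int k) x)))
          - ?s ((-1) ^ (p * q) * (-1) powi l) (
             ?s (log_coeff k) (Y V (?H k v) (l + n - int i - int k) (Y V u (m + int i) x))
             + ?s ((-1) ^ q) (?s (log_coeff k) (Y V v (l + n - int i) (Y V (?H k u) (m + int i - int k) x))))" for k
      proof -
        have "(-1) ^ p * ((-1) ^ (p * ((1 + q) mod 2)) * (-1) powi l) = (-1) ^ (p * q) * ((-1::complex) powi l)"
          by (simp add: s2[symmetric])
        then show ?thesis
          unfolding R1_def R2_def s1
          by (simp add: vs.scale_right_distrib vs.scale_right_diff_distrib algebra_simps)
      qed
      then show ?thesis
        by (simp add: e mode_sum_right mode_scale_right carrier_closed vs.scale_sum_right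
            sum.distrib sum_subtractf vs.scale_right_distrib)
    qed
    have "(\<Sum>i\<le>N. ?s (of_int m gchoose i) (deform (Y V u (l + int i) v) (m + n - int i) x))
      = (\<Sum>k\<le>N. ?s (log_coeff k) (?s ((-1) ^ p) (\<Sum>i\<le>N. ?s (of_int m gchoose i) (G' k i))))
       + (\<Sum>i\<le>N. ?s (of_int m gchoose i) (\<Sum>k\<le>2 * N. ?s (log_coeff k) (\<Sum>j\<le>k. ?s (of_nat (k choose j)) (G j (i + (k - j))))))"
    proof -
      have "(\<Sum>i\<le>N. ?s (of_int m gchoose i) (?s ((-1) ^ p) (\<Sum>k\<le>N. ?s (log_coeff k) (G' k i))))
         = (\<Sum>k\<le>N. ?s (log_coeff k) (?s ((-1) ^ p) (\<Sum>i\<le>N. ?s (of_int m gchoose i) (G' k i))))"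
        unfolding vs.scale_sum_right by (subst sum.swap) (simp add: mult_ac)
      then show ?thesis
        unfolding dl by (simp only: vs.scale_right_distrib sum.distrib)
    qed
    \<comment> \<open>The convolution replaces m by m - k, which is where \<open>J1\<close>
      applies.\<close>
    also have "(\<Sum>i\<le>N. ?s (of_int m gchoose i) (\<Sum>k\<le>2 * N. ?s (log_coeff k) (\<Sum>j\<le>k. ?s (of_nat (k choose j)) (G j (i + (k - j))))))
       = (\<Sum>k\<le>N. ?s (log_coeff k) (\<Sum>s\<le>N. ?s ((of_int m - of_nat k) gchoose s) (G k s)))"
      by (rule sum_log_coeff_reindex) (use vs.module_axioms G0 in auto)
    also have "(\<Sum>k\<le>N. ?s (log_coeff k) (?s ((-1) ^ p) (\<Sum>i\<le>N. ?s (of_int m gchoose i) (G' k i)))) + \<dots>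
       = (\<Sum>i\<le>N. ?s ((-1) ^ i * (of_int l gchoose i)) (\<Sum>k\<le>N. ?s (log_coeff k) (R1 k i + ?s ((-1) ^ p) (R2 k i))))"
      unfolding J1 J2 vs.scale_sum_right
      by (subst (3) sum.swap) (simp add: vs.scale_right_distrib sum.distrib mult_ac add_ac)
    finally show ?case unfolding dr .
  qed
qed

end

subsection \<open>The deformed module\<close>

context vertex_operator_superalgebra
begin

lemma conf_carrier [simp, intro]: "conf V \<in> vcarrier V"
  using parity_carrier[OF _ conf_even] by simp

lemma L_closed [simp, intro]: "v \<in> vcarrier V \<Longrightarrow> L V n v \<in> vcarrier V"
  by (simp add: L_def)

lemma L_add: "u \<in> vcarrier V \<Longrightarrow> v \<in> vcarrier V \<Longrightarrow> L V n (u + v) = L V n u + L V n v"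
  by (simp add: L_def mode_add_right)

lemma L_scale: "v \<in> vcarrier V \<Longrightarrow> L V n (vscale V a v) = vscale V a (L V n v)"
  by (simp add: L_def mode_scale_right)

lemma L_sum: "(\<And>i. i \<in> I \<Longrightarrow> g i \<in> vcarrier V) \<Longrightarrow> L V n (sum g I) = (\<Sum>i\<in>I. L V n (g i))"
  by (simp add: L_def mode_sum_right)

lemma weight_space_subspace: "vs.subspace (weight_space V k)"
  by (rule vs.subspaceI) (auto simp: weight_space_def L_add L_scale vs.scale_right_distrib
      vs.scale_left_commute, simp add: L_def)

lemma weight_space_carrier: "v \<in> weight_space V k \<Longrightarrow> v \<in> vcarrier V"
  by (simp add: weight_space_def)

lemma weight_decomposition:
  assumes "v \<in> vcarrier V"
  obtains g n where "\<And>k. g k \<in> weight_space V (int k)" "v = (\<Sum>k<n. g k)"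
proof -
  have "v \<in> vs.span (\<Union>k::nat. weight_space V (int k))" using assms grading by simp
  then have "\<exists>g n. (\<forall>k. g k \<in> weight_space V (int k)) \<and> v = (\<Sum>k<n. g k)"
  proof (induction rule: vs.span_induct_alt)
    case base
    show ?case
      by (rule exI[of _ "\<lambda>_. 0"]) (auto simp: vs.subspace_0[OF weight_space_subspace])
  next
    case (step a x y)
    obtain j where j: "x \<in> weight_space V (int j)" using step by auto
    obtain g n where g: "\<forall>k. g k \<in> weight_space V (int k)" "y = (\<Sum>k<n. g k)" using step by auto
    \<comment> \<open>\<open>g\<close> may be nonzero from index \<open>n\<close> on, so it is cut
      off before the new component is added in weight \<open>j\<close>.\<close>
    define g' where "g' k = (if k < n then g k else 0) + (if k = j then vscale V a x else 0)" for k
    have "g' k \<in> weight_space V (int k)" for k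
      using g(1) j weight_space_subspace[of "int k"]
      by (auto simp: g'_def intro!: vs.subspace_add vs.subspace_scale dest: vs.subspace_0)
    moreover have "vscale V a x + y = (\<Sum>k<max n (Suc j). g' k)"
    proof -
      have "(\<Sum>k<max n (Suc j). (if k < n then g k else 0)) = (\<Sum>k<n. g k)"
        by (rule sum.mono_neutral_cong_right) auto
      then show ?thesis
        by (simp add: g'_def sum.distrib g(2) add.commute less_max_iff_disj)
    qed
    ultimately show ?case by blast
  qed
  then show thesis using that by blast
qed

text \<open>L(0) - j kills the component of weight j and rescales the others by nonzero factors k -
  j.\<close>

lemma weight_independent:
  assumes "finite K" "\<And>k. k \<in> K \<Longrightarrow> g k \<in> weight_space V (int k)" "(\<Sum>k\<in>K. g k) = 0"
  shows "\<forall>k\<in>K. g k = 0"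
  using assms
proof (induction K arbitrary: g rule: finite_induct)
  case (insert j K)
  have C: "g k \<in> vcarrier V" "L V 0 (g k) = vscale V (of_nat k) (g k)" if "k \<in> insert j K" for k
    using insert.prems(1)[OF that] by (auto simp: weight_space_def)
  let ?g = "\<lambda>k. vscale V (of_nat k - of_nat j) (g k)"
  have "0 = L V 0 (\<Sum>k\<in>insert j K. g k) - vscale V (of_nat j) (\<Sum>k\<in>insert j K. g k)"
    unfolding insert.prems(2) by (simp add: L_def)
  also have "\<dots> = (\<Sum>k\<in>insert j K. ?g k)"
    by (simp only: L_sum C(1) C(2) vs.scale_sum_right sum_subtractf[symmetric] vs.scale_left_diff_distrib
        cong: sum.cong)
  also have "\<dots> = (\<Sum>k\<in>K. ?g k)" using insert.hyps by simp
  finally have "(\<Sum>k\<in>K. ?g k) = 0" by simp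
  moreover have "?g k \<in> weight_space V (int k)" if "k \<in> K" for k
    using that insert.prems(1) weight_space_subspace vs.subspace_scale by blast
  ultimately have "\<forall>k\<in>K. ?g k = 0" by (rule insert.IH[rotated])
  then have "\<forall>k\<in>K. g k = 0" using insert.hyps by auto
  then show ?case using insert.prems(2) insert.hyps by simp
qed simp

text \<open>L(0) is semisimple: its N-th shifted power multiplies the component of weight k by (k -
  \<mu>)^N, so only the component with k = \<mu> can be nonzero.\<close>

lemma generalized_eigenvector:
  assumes v: "v \<in> vcarrier V" "((\<lambda>x. L V 0 x - vscale V \<mu> x) ^^ N) v = 0" "v \<noteq> 0"
  shows "\<exists>k::nat. \<mu> = of_nat k \<and> v \<in> weight_space V (int k)"
proof -
  let ?T = "\<lambda>x. L V 0 x - vscale V \<mu> x"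
  obtain g n where g: "\<And>k. g k \<in> weight_space V (int k)" "v = (\<Sum>k<n. g k)"
    by (rule weight_decomposition[OF v(1)]) (rule that)
  then have C: "g k \<in> vcarrier V" "L V 0 (g k) = vscale V (of_nat k) (g k)" for k
    by (auto simp: weight_space_def)
  have "(?T ^^ i) v = (\<Sum>k<n. vscale V ((of_nat k - \<mu>) ^ i) (g k))" for i
  proof (induction i)
    case (Suc i)
    have "?T (\<Sum>k<n. vscale V (a k) (g k)) = (\<Sum>k<n. vscale V ((of_nat k - \<mu>) * a k) (g k))" for a
      by (simp add: L_sum L_scale C carrier_closed vs.scale_sum_right sum_subtractf[symmetric]
          left_diff_distrib right_diff_distrib vs.scale_left_diff_distrib mult.commute)
    then show ?case using Suc by simp
  qed (simp add: g(2))
  then have "(\<Sum>k<n. vscale V ((of_nat k - \<mu>) ^ N) (g k)) = 0" using v(2) by simp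
  then have "\<forall>k\<in>{..<n}. vscale V ((of_nat k - \<mu>) ^ N) (g k) = 0"
    using g(1) weight_space_subspace vs.subspace_scale by (intro weight_independent) auto
  then have *: "g k = 0" if "k < n" "of_nat k \<noteq> \<mu>" for k using that by auto
  obtain k where k: "k < n" "g k \<noteq> 0" using v(3) unfolding g(2) by (metis lessThan_iff sum.neutral)
  then have mu: "\<mu> = of_nat k" using * by metis
  have "v = (\<Sum>k\<in>{k}. g k)"
    unfolding g(2) by (rule sum.mono_neutral_right) (use k mu * in auto)
  then show ?thesis using mu g(1)[of k] by auto
qed

end

text \<open>\<open>code x y\<close> stands for x + \<theta> y in an abstract target, so that the
  module can be placed inside \<open>nat \<Rightarrow> complex\<close> afterwards.
  \<open>deform_conf\<close> expresses that L(0) acquires no \<theta>-term.\<close>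

locale deformed_module =
  odd_deformation V h + vertex_operator_superalgebra V c
  for V :: "('v::ab_group_add) vosa" and h c +
  fixes wscale :: "complex \<Rightarrow> 'w::ab_group_add \<Rightarrow> 'w"
    and code :: "'v \<Rightarrow> 'v \<Rightarrow> 'w"
  assumes w_vector_space: "vector_space wscale"
    and code_add: "code (x + x') (y + y') = code x y + code x' y'"
    and code_scale: "code (vscale V a x) (vscale V a y) = wscale a (code x y)"
    and code_eq_0: "x \<in> vcarrier V \<Longrightarrow> y \<in> vcarrier V \<Longrightarrow> code x y = 0 \<Longrightarrow> x = 0 \<and> y = 0"
    and deform_conf: "x \<in> vcarrier V \<Longrightarrow> deform (conf V) 1 x = 0"
begin

sublocale ws: vector_space wscale
  by (rule w_vector_space)

text \<open>The choice is unique on the image of the carrier by \<open>code_inj\<close>; elsewhere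
  the value is arbitrary.\<close>

definition decode :: "'w \<Rightarrow> 'v \<times> 'v" where
  "decode w = (SOME z. z \<in> vcarrier V \<times> vcarrier V \<and> w = code (fst z) (snd z))"

text \<open>Modes of even states commute with \<theta>, hence no sign in front of the action on the
  second component.\<close>

definition deformed :: "('v, 'w) vmod" where
  "deformed = \<lparr>mscale = wscale, mcarrier = {code x y | x y. x \<in> vcarrier V \<and> y \<in> vcarrier V},
    YM = (\<lambda>u m w. code (Y V u m (fst (decode w)))
      (Y V u m (snd (decode w)) + deform u m (fst (decode w))))\<rparr>"

lemma code_0 [simp]: "code 0 0 = 0"
  using code_add[of 0 0 0 0] by simp

lemma code_diff: "code (x - x') (y - y') = code x y - code x' y'"
  using code_add[of "x - x'" x' "y - y'" y'] by simp

lemma code_sum: "(\<Sum>i\<in>I. code (g i) (g' i)) = code (sum g I) (sum g' I)"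
  by (induction I rule: infinite_finite_induct) (auto simp: code_add)

lemma code_inj:
  assumes "x \<in> vcarrier V" "y \<in> vcarrier V" "x' \<in> vcarrier V" "y' \<in> vcarrier V"
  shows "code x y = code x' y' \<longleftrightarrow> x = x' \<and> y = y'"
  using code_eq_0[of "x - x'" "y - y'"] assms by (auto simp: code_diff carrier_closed)

lemma decode_code:
  assumes "x \<in> vcarrier V" "y \<in> vcarrier V"
  shows "decode (code x y) = (x, y)"
  unfolding decode_def
proof (rule some_equality)
  fix z assume "z \<in> vcarrier V \<times> vcarrier V \<and> code x y = code (fst z) (snd z)"
  then show "z = (x, y)" using assms code_inj by (cases z) auto
qed (use assms in auto)

lemma deformed_simps [simp]:
  "mscale deformed = wscale"
  "w \<in> mcarrier deformed \<longleftrightarrow> (\<exists>x y. w = code x y \<and> x \<in> vcarrier V \<and> y \<in> vcarrier V)"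
  "x \<in> vcarrier V \<Longrightarrow> y \<in> vcarrier V
    \<Longrightarrow> YM deformed u m (code x y) = code (Y V u m x) (Y V u m y + deform u m x)"
  by (auto simp: deformed_def decode_code)

lemma deformed_mode_zero [simp]: "u \<in> vcarrier V \<Longrightarrow> YM deformed u m 0 = 0"
  using deformed_simps(3)[of 0 0 u m] by simp

lemma even_part_simps [simp]:
  "vscale (even_part V) = vscale V" "vcarrier (even_part V) = parity V 0" "Y (even_part V) = Y V"
  "vac (even_part V) = vac V" "conf (even_part V) = conf V"
  by (simp_all add: even_part_def)

lemma even_carrier: "u \<in> parity V 0 \<Longrightarrow> u \<in> vcarrier V"
  using parity_carrier[of 0] by simp

lemma deformed_carrier_subspace: "ws.subspace (mcarrier deformed)"
proof (rule ws.subspaceI)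
  show "0 \<in> mcarrier deformed" using code_0 by (metis carrier_closed(1) deformed_simps(2))
next
  fix w w' assume "w \<in> mcarrier deformed" "w' \<in> mcarrier deformed"
  then show "w + w' \<in> mcarrier deformed"
    by auto (metis code_add carrier_closed(2))
next
  fix a w assume "w \<in> mcarrier deformed"
  then show "wscale a w \<in> mcarrier deformed"
    by auto (metis code_scale carrier_closed(3))
qed

text \<open>The component without \<theta> is the Jacobi identity on x; the \<theta>-component is
  the Jacobi identity on y plus \<open>deform_jacobi\<close> on x with p = q = 0.\<close>

lemma deformed_jacobi:
  assumes u: "u \<in> parity V 0" and v: "v \<in> parity V 0" and w: "w \<in> mcarrier deformed"
  shows "jacobi wscale (Y V) (YM deformed) 1 u v w"
  unfolding jacobi_def
proof (intro allI)
  fix l m n :: int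
  have C [simp, intro]: "u \<in> vcarrier V" "v \<in> vcarrier V" using u v even_carrier by auto
  obtain x y where w: "w = code x y" and xy [simp, intro]: "x \<in> vcarrier V" "y \<in> vcarrier V"
    using w by auto
  let ?D = "\<lambda>N. (\<Sum>i\<le>N. vscale V (of_int m gchoose i) (deform (Y V u (l + int i) v) (m + n - int i) x))
    = (\<Sum>i\<le>N. vscale V ((-1) ^ i * (of_int l gchoose i))
        (deform u (l + m - int i) (Y V v (n + int i) x)
         + vscale V ((-1) ^ 0) (Y V u (l + m - int i) (deform v (n + int i) x))
         - vscale V ((-1) ^ (0 * 0) * (-1) powi l)
            (deform v (l + n - int i) (Y V u (m + int i) x)
             + vscale V ((-1) ^ 0) (Y V v (l + n - int i) (deform u (m + int i) x)))))"
  have "\<forall>\<^sub>F N in sequentially. ?D N \<and> (\<forall>i>N. Y V u (l + int i) v = 0)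
    \<and> (\<forall>i>N. Y V v (n + int i) x = 0) \<and> (\<forall>i>N. Y V u (m + int i) x = 0)
    \<and> (\<forall>i>N. Y V v (n + int i) y = 0) \<and> (\<forall>i>N. Y V u (m + int i) y = 0)
    \<and> (\<forall>i>N. deform v (n + int i) x = 0) \<and> (\<forall>i>N. deform u (m + int i) x = 0)"
    by (intro eventually_conj deform_jacobi mode_eventually_zero deform_eventually_zero C xy u v)
      simp_all
  from eventually_happens'[OF sequentially_bot this] obtain N where D: "?D N"
    and t: "\<And>i. i > N \<Longrightarrow> Y V u (l + int i) v = 0"
    "\<And>i. i > N \<Longrightarrow> Y V v (n + int i) x = 0" "\<And>i. i > N \<Longrightarrow> Y V u (m + int i) x = 0"
    "\<And>i. i > N \<Longrightarrow> Y V v (n + int i) y = 0" "\<And>i. i > N \<Longrightarrow> Y V u (m + int i) y = 0"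
    "\<And>i. i > N \<Longrightarrow> deform v (n + int i) x = 0" "\<And>i. i > N \<Longrightarrow> deform u (m + int i) x = 0"
    by (elim exE conjE) blast
  note Jx = jacobi_finite[of 0 0, OF _ _ u v xy(1) t(1-3)]
  note Jy = jacobi_finite[of 0 0, OF _ _ u v xy(2) t(1,4,5)]
  have lhs: "wscale (of_int m gchoose i) (YM deformed (Y V u (l + int i) v) (m + n - int i) w)
    = code (vscale V (of_int m gchoose i) (Y V (Y V u (l + int i) v) (m + n - int i) x))
       (vscale V (of_int m gchoose i) (Y V (Y V u (l + int i) v) (m + n - int i) y)
        + vscale V (of_int m gchoose i) (deform (Y V u (l + int i) v) (m + n - int i) x))" for i
    by (simp add: w code_scale[symmetric] vs.scale_right_distrib)
  have rhs: "wscale ((-1) ^ i * (of_int l gchoose i))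
      (YM deformed u (l + m - int i) (YM deformed v (n + int i) w)
       - wscale (1 * (-1) powi l) (YM deformed v (l + n - int i) (YM deformed u (m + int i) w)))
    = code (vscale V ((-1) ^ i * (of_int l gchoose i))
        (Y V u (l + m - int i) (Y V v (n + int i) x)
         - vscale V ((-1) ^ (0 * 0) * (-1) powi l) (Y V v (l + n - int i) (Y V u (m + int i) x))))
      (vscale V ((-1) ^ i * (of_int l gchoose i))
        (Y V u (l + m - int i) (Y V v (n + int i) y)
         - vscale V ((-1) ^ (0 * 0) * (-1) powi l) (Y V v (l + n - int i) (Y V u (m + int i) y)))
       + vscale V ((-1) ^ i * (of_int l gchoose i))
        (deform u (l + m - int i) (Y V v (n + int i) x)
         + vscale V ((-1) ^ 0) (Y V u (l + m - int i) (deform v (n + int i) x))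
         - vscale V ((-1) ^ (0 * 0) * (-1) powi l)
            (deform v (l + n - int i) (Y V u (m + int i) x)
             + vscale V ((-1) ^ 0) (Y V v (l + n - int i) (deform u (m + int i) x)))))" for i
    by (simp add: w code_scale[symmetric] code_diff[symmetric] carrier_closed mode_add_right
        vs.scale_right_distrib vs.scale_right_diff_distrib algebra_simps)
  have "Sum_any (\<lambda>i. wscale (of_int m gchoose i) (YM deformed (Y V u (l + int i) v) (m + n - int i) w))
    = (\<Sum>i\<le>N. wscale (of_int m gchoose i) (YM deformed (Y V u (l + int i) v) (m + n - int i) w))"
    by (rule Sum_any_eq_sum_atMost) (simp add: t w)
  moreover have "Sum_any (\<lambda>i. wscale ((-1) ^ i * (of_int l gchoose i))
      (YM deformed u (l + m - int i) (YM deformed v (n + int i) w)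
       - wscale (1 * (-1) powi l) (YM deformed v (l + n - int i) (YM deformed u (m + int i) w))))
    = (\<Sum>i\<le>N. wscale ((-1) ^ i * (of_int l gchoose i))
      (YM deformed u (l + m - int i) (YM deformed v (n + int i) w)
       - wscale (1 * (-1) powi l) (YM deformed v (l + n - int i) (YM deformed u (m + int i) w))))"
    by (rule Sum_any_eq_sum_atMost) (simp add: t w)
  ultimately show "Sum_any (\<lambda>i. wscale (of_int m gchoose i) (YM deformed (Y V u (l + int i) v) (m + n - int i) w))
    = Sum_any (\<lambda>i. wscale ((-1) ^ i * (of_int l gchoose i))
      (YM deformed u (l + m - int i) (YM deformed v (n + int i) w)
       - wscale (1 * (-1) powi l) (YM deformed v (l + n - int i) (YM deformed u (m + int i) w))))"
    unfolding lhs rhs code_sum sum.distrib using Jx Jy D by (simp only:)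
qed

lemma deformed_weak_module: "weak_module (even_part V) deformed"
proof (rule weak_module.intro)
  fix v w n assume "v \<in> vcarrier (even_part V)" "w \<in> mcarrier deformed"
  then have v: "v \<in> vcarrier V" and "w \<in> mcarrier deformed" using even_carrier by auto
  then obtain x y where w: "w = code x y" "x \<in> vcarrier V" "y \<in> vcarrier V" by auto
  have "YM deformed v n w = code (Y V v n x) (Y V v n y + deform v n x)" using w by simp
  then show "YM deformed v n w \<in> mcarrier deformed"
    using w v by (metis carrier_closed(2) mode_closed deform_closed deformed_simps(2))
  have "\<forall>\<^sub>F N in sequentially. (\<forall>i>N. Y V v (0 + int i) x = 0) \<and> (\<forall>i>N. Y V v (0 + int i) y = 0)
     \<and> (\<forall>i>N. deform v (0 + int i) x = 0)"
    by (intro eventually_conj mode_eventually_zero deform_eventually_zero v w)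
  then obtain N where N: "\<forall>i>N. Y V v (0 + int i) x = 0" "\<forall>i>N. Y V v (0 + int i) y = 0"
    "\<forall>i>N. deform v (0 + int i) x = 0"
    unfolding eventually_sequentially by (meson order_refl)
  have "YM deformed v n w = 0" if "n \<ge> int N + 1" for n
    using N[rule_format, of "nat n"] that w by simp
  then show "\<exists>N. \<forall>n\<ge>N. YM deformed v n w = 0" by blast
next
  fix v v' w n assume "v \<in> vcarrier (even_part V)" "v' \<in> vcarrier (even_part V)" "w \<in> mcarrier deformed"
  then show "YM deformed (v + v') n w = YM deformed v n w + YM deformed v' n w"
    by (auto simp: even_carrier mode_add_left deform_add_left code_add[symmetric] add_ac)
next
  fix v w n a assume "v \<in> vcarrier (even_part V)" "w \<in> mcarrier deformed"
  then show "YM deformed (vscale (even_part V) a v) n w = mscale deformed a (YM deformed v n w)"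
    by (auto simp: even_carrier mode_scale_left deform_scale_left code_scale[symmetric] vs.scale_right_distrib)
next
  fix v w w' n assume "v \<in> vcarrier (even_part V)" "w \<in> mcarrier deformed" "w' \<in> mcarrier deformed"
  then show "YM deformed v n (w + w') = YM deformed v n w + YM deformed v n w'"
    by (auto simp: even_carrier mode_add_right deform_add_right code_add[symmetric] add_ac carrier_closed)
next
  fix v w n a assume "v \<in> vcarrier (even_part V)" "w \<in> mcarrier deformed"
  then show "YM deformed v n (mscale deformed a w) = mscale deformed a (YM deformed v n w)"
    by (auto simp: even_carrier mode_scale_right deform_scale_right code_scale[symmetric]
        vs.scale_right_distrib carrier_closed)
next
  fix w n assume "w \<in> mcarrier deformed"
  then show "YM deformed (vac (even_part V)) n w = (if n = -1 then w else 0)"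
    by (auto simp: vac_mode)
next
  fix u v w assume "u \<in> vcarrier (even_part V)" "v \<in> vcarrier (even_part V)" "w \<in> mcarrier deformed"
  then show "jacobi (mscale deformed) (Y (even_part V)) (YM deformed) 1 u v w"
    using deformed_jacobi by simp
qed (use deformed_carrier_subspace w_vector_space in simp_all)

section \<open>L(0)-grading of the deformed module and membership in \<open>Mod\<close>\<close>

lemma L0_power:
  assumes "x \<in> vcarrier V" "y \<in> vcarrier V"
  shows "((\<lambda>w. YM deformed (conf V) 1 w - wscale \<mu> w) ^^ k) (code x y)
    = code (((\<lambda>z. L V 0 z - vscale V \<mu> z) ^^ k) x) (((\<lambda>z. L V 0 z - vscale V \<mu> z) ^^ k) y)"
proof -
  let ?T = "\<lambda>z. L V 0 z - vscale V \<mu> z"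
  have C: "(?T ^^ k) z \<in> vcarrier V" if "z \<in> vcarrier V" for z k
    using that by (induction k) (simp_all add: L_closed carrier_closed)
  have "YM deformed (conf V) 1 (code z z') - wscale \<mu> (code z z') = code (?T z) (?T z')"
    if "z \<in> vcarrier V" "z' \<in> vcarrier V" for z z'
    using that by (simp add: deform_conf code_diff code_scale L_def)
  with C assms show ?thesis
    by (induction k) simp_all
qed

lemma gen_weight_space_subset:
  assumes "w \<in> gen_weight_space (even_part V) deformed \<mu>" "w \<noteq> 0"
  obtains k :: nat and x y where "\<mu> = of_nat k" "w = code x y"
    "x \<in> weight_space V (int k)" "y \<in> weight_space V (int k)"
proof -
  obtain k x y where xy: "w = code x y" "x \<in> vcarrier V" "y \<in> vcarrier V"
    and "((\<lambda>w. YM deformed (conf V) 1 w - wscale \<mu> w) ^^ k) w = 0"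
    using assms by (auto simp: gen_weight_space_def)
  then have "code (((\<lambda>z. L V 0 z - vscale V \<mu> z) ^^ k) x) (((\<lambda>z. L V 0 z - vscale V \<mu> z) ^^ k) y) = 0"
    by (simp add: L0_power)
  moreover have "((\<lambda>z. L V 0 z - vscale V \<mu> z) ^^ k) z \<in> vcarrier V" if "z \<in> vcarrier V" for z
    using that by (induction k) auto
  ultimately have 0: "((\<lambda>z. L V 0 z - vscale V \<mu> z) ^^ k) x = 0" "((\<lambda>z. L V 0 z - vscale V \<mu> z) ^^ k) y = 0"
    using code_eq_0 xy by auto
  have z: "0 \<in> weight_space V j" for j by (rule vs.subspace_0[OF weight_space_subspace])
  have "x = 0 \<or> (\<exists>k. \<mu> = of_nat k \<and> x \<in> weight_space V (int k))"
    "y = 0 \<or> (\<exists>k. \<mu> = of_nat k \<and> y \<in> weight_space V (int k))"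
    using generalized_eigenvector xy 0 by blast+
  \<comment> \<open>A vanishing component lies in every weight space; two nonzero components have
    the same weight because both weights equal \<mu>.\<close>
  then have "\<exists>k::nat. \<mu> = of_nat k \<and> x \<in> weight_space V (int k) \<and> y \<in> weight_space V (int k)"
    using assms(2) xy(1) code_0 z by (metis of_nat_eq_iff)
  then show thesis using that xy(1) by blast
qed

lemma code_in_gen_weight_space:
  assumes "x \<in> weight_space V (int k)" "y \<in> weight_space V (int k)"
  shows "code x y \<in> gen_weight_space (even_part V) deformed (of_nat k)"
proof -
  have xy: "x \<in> vcarrier V" "y \<in> vcarrier V" using assms weight_space_carrier by auto
  have "((\<lambda>w. YM deformed (conf V) 1 w - wscale (of_nat k) w) ^^ 1) (code x y) = 0"
    unfolding L0_power[OF xy] using assms by (simp add: weight_space_def)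
  then show ?thesis unfolding gen_weight_space_def using xy by (auto intro!: exI[of _ 1])
qed

text \<open>Nonzero generalized weight spaces occur only for natural numbers, and each consists of
  two copies of a finite-dimensional weight space of \<open>V\<close>. Only finitely many lie below
  a given real part.\<close>

lemma deformed_in_Mod: "deformed \<in> Mod (even_part V)"
  unfolding Mod_def mem_Collect_eq deformed_simps(1)
proof (intro conjI allI)
  show "weak_module (even_part V) deformed" by (rule deformed_weak_module)
  let ?W = "gen_weight_space (even_part V) deformed"
  show "mcarrier deformed = ws.span (\<Union>\<mu>. ?W \<mu>)"
  proof (intro antisym subsetI)
    fix w assume "w \<in> mcarrier deformed"
    then obtain x y where w: "w = code x y" "x \<in> vcarrier V" "y \<in> vcarrier V" by auto
    obtain g n where g: "\<And>k. g k \<in> weight_space V (int k)" "x = (\<Sum>k<n. g k)"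
      by (rule weight_decomposition[OF w(2)]) (rule that)
    obtain g' n' where g': "\<And>k. g' k \<in> weight_space V (int k)" "y = (\<Sum>k<n'. g' k)"
      by (rule weight_decomposition[OF w(3)]) (rule that)
    have "0 \<in> weight_space V j" for j by (rule vs.subspace_0[OF weight_space_subspace])
    then have z: "code (g k) 0 \<in> ?W (of_nat k)" "code 0 (g' k) \<in> ?W (of_nat k)" for k
      using g(1) g'(1) code_in_gen_weight_space by simp_all
    have "w = code x 0 + code 0 y" by (simp add: w code_add[symmetric])
    also have "\<dots> = (\<Sum>k<n. code (g k) 0) + (\<Sum>k<n'. code 0 (g' k))"
      by (simp add: code_sum g g')
    also have "\<dots> \<in> ws.span (\<Union>\<mu>. ?W \<mu>)"
      by (intro ws.span_add ws.span_sum ws.span_base) (rule UN_I[OF UNIV_I], rule z)+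
    finally show "w \<in> ws.span (\<Union>\<mu>. ?W \<mu>)" .
  next
    have "(\<Union>\<mu>. ?W \<mu>) \<subseteq> mcarrier deformed" unfolding gen_weight_space_def by blast
    then show "w \<in> ws.span (\<Union>\<mu>. ?W \<mu>) \<Longrightarrow> w \<in> mcarrier deformed" for w
      using ws.span_minimal[OF _ deformed_carrier_subspace] by blast
  qed
  fix r :: complex
  obtain B where B: "\<And>k. finite (B k)" "\<And>k. weight_space V k \<subseteq> vs.span (B k)"
    using weight_fin_dim unfolding fin_dim_def by metis
  \<comment> \<open>For negative real part \<open>nat\<close> returns 0, and \<open>D\<close> is
    still a finite set whose span is large enough.\<close>
  define D where "D = (\<Union>k\<le>nat \<lceil>Re r\<rceil>. (\<lambda>b. code b 0) ` B (int k) \<union> (\<lambda>b. code 0 b) ` B (int k))"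
  have "w \<in> ws.span D" if w: "w \<in> ?W \<mu>" "Re \<mu> \<le> Re r" for w \<mu>
  proof (cases "w = 0")
    case False
    then obtain k x y where k: "\<mu> = of_nat k" "w = code x y"
      "x \<in> weight_space V (int k)" "y \<in> weight_space V (int k)"
      using gen_weight_space_subset w(1) by blast
    then have "k \<le> nat \<lceil>Re r\<rceil>" using w(2) by simp linarith
    then have sub: "(\<lambda>b. code b 0) ` B (int k) \<subseteq> D" "(\<lambda>b. code 0 b) ` B (int k) \<subseteq> D"
      by (auto simp: D_def)
    have "z \<in> vs.span (B (int k)) \<Longrightarrow> code z 0 \<in> ws.span D" for z
    proof (induction rule: vs.span_induct_alt)
      case (step a b z)
      have "code (vscale V a b + z) 0 = wscale a (code b 0) + code z 0"
        using code_add[of "vscale V a b" z 0 0] code_scale[of a b 0] by simp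
      then show ?case
        using step sub by (auto intro!: ws.span_add[OF ws.span_scale[OF ws.span_base]])
    qed (simp add: ws.span_zero)
    moreover have "z \<in> vs.span (B (int k)) \<Longrightarrow> code 0 z \<in> ws.span D" for z
    proof (induction rule: vs.span_induct_alt)
      case (step a b z)
      have "code 0 (vscale V a b + z) = wscale a (code 0 b) + code 0 z"
        using code_add[of 0 0 "vscale V a b" z] code_scale[of a 0 b] by simp
      then show ?case
        using step sub by (auto intro!: ws.span_add[OF ws.span_scale[OF ws.span_base]])
    qed (simp add: ws.span_zero)
    ultimately have "code x 0 + code 0 y \<in> ws.span D"
      using k B(2) by (intro ws.span_add) blast+
    then show ?thesis by (simp add: k code_add[symmetric])
  qed (simp add: ws.span_zero)
  then have "ws.span (\<Union>\<mu>\<in>{\<mu>. Re \<mu> \<le> Re r}. ?W \<mu>) \<subseteq> ws.span D"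
    by (intro ws.span_minimal) auto
  moreover have "finite D" using B(1) by (auto simp: D_def)
  ultimately show "fin_dim wscale (ws.span (\<Union>\<mu>\<in>{\<mu>. Re \<mu> \<le> Re r}. ?W \<mu>))"
    unfolding fin_dim_def by blast
qed

section \<open>A proper submodule containing Omega\<close>

lemma Omega_D:
  assumes "code x y \<in> Omega (even_part V) deformed" "x \<in> vcarrier V" "y \<in> vcarrier V"
    and "v \<in> weight_space V k" "v \<in> parity V 0" "k - n - 1 < 0"
  shows "Y V v n y + deform v n x = 0"
proof -
  have v: "v \<in> weight_space (even_part V) k"
    using assms by (simp add: weight_space_def L_def)
  have C: "v \<in> vcarrier V" using assms(5) even_carrier by simp
  have "YM deformed v n (code x y) = 0"
    using assms(1,6) v by (auto simp: Omega_def)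
  then have "code (Y V v n x) (Y V v n y + deform v n x) = 0"
    using assms(2,3) by simp
  then show ?thesis
    using code_eq_0[of "Y V v n x" "Y V v n y + deform v n x"] assms(2,3) C by auto
qed

text \<open>Even states preserve the parity of the first component, and \<open>deform\<close> only
  feeds the second one, so the vectors with even first component form a submodule. It misses
  \<open>code x 0\<close> for every x that is not even.\<close>

lemma not_lowest_generated:
  assumes "\<And>x y. x \<in> vcarrier V \<Longrightarrow> y \<in> vcarrier V \<Longrightarrow> code x y \<in> Omega (even_part V) deformed
      \<Longrightarrow> x \<in> parity V 0"
    and "\<not> vcarrier V \<subseteq> parity V 0"
  shows "\<not> lowest_generated (even_part V) deformed"
proof
  assume lg: "lowest_generated (even_part V) deformed"
  define U where "U = {code x y | x y. x \<in> parity V 0 \<and> y \<in> vcarrier V}"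
  have P: "vs.subspace (parity V 0)" by (rule parity_subspace) simp
  have "submodule (even_part V) deformed U"
    unfolding submodule_def
  proof (intro conjI ballI allI)
    show "U \<subseteq> mcarrier deformed"
      by (simp only: U_def subset_iff deformed_simps mem_Collect_eq) (metis even_carrier)
    have "ws.subspace U"
    proof (rule ws.subspaceI)
      show "0 \<in> U" unfolding U_def using code_0 vs.subspace_0[OF P] by force
    next
      fix w w' assume "w \<in> U" "w' \<in> U"
      then show "w + w' \<in> U"
        unfolding U_def using vs.subspace_add[OF P] by auto (metis code_add carrier_closed(2))
    next
      fix a w assume "w \<in> U"
      then show "wscale a w \<in> U"
        unfolding U_def using vs.subspace_scale[OF P] by auto (metis code_scale carrier_closed(3))
    qed
    then show "module.subspace (mscale deformed) U" by simp
  next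
    fix v n w assume v: "v \<in> vcarrier (even_part V)" and "w \<in> U"
    then obtain x y where w: "w = code x y" "x \<in> parity V 0" "y \<in> vcarrier V" by (auto simp: U_def)
    have "Y V v n x \<in> parity V 0" using mode_parity[of 0 0 v x n] v w by simp
    moreover have "YM deformed v n w = code (Y V v n x) (Y V v n y + deform v n x)"
      "Y V v n y + deform v n x \<in> vcarrier V"
      using w v even_carrier by (simp_all add: carrier_closed)
    ultimately show "YM deformed v n w \<in> U" unfolding U_def by blast
  qed
  moreover have "Omega (even_part V) deformed \<subseteq> U"
  proof
    fix w assume w: "w \<in> Omega (even_part V) deformed"
    then have "w \<in> mcarrier deformed" by (simp add: Omega_def)
    then obtain x y where "w = code x y" "x \<in> vcarrier V" "y \<in> vcarrier V" by auto
    then show "w \<in> U" using assms(1) w unfolding U_def by blast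
  qed
  ultimately have "mcarrier deformed \<subseteq> U"
    using lg unfolding lowest_generated_def generated_submodule_def by blast
  moreover obtain x where x: "x \<in> vcarrier V" "x \<notin> parity V 0" using assms(2) by blast
  then have "code x 0 \<in> mcarrier deformed" by (metis carrier_closed(1) deformed_simps(2))
  ultimately obtain x' y' where "code x 0 = code x' y'" "x' \<in> parity V 0" "y' \<in> vcarrier V"
    unfolding U_def by blast
  then show False using x code_inj[of x 0 x' y'] even_carrier by auto
qed

end

subsection \<open>Symplectic fermions\<close>

context symplectic_fermion
begin

lemma st_carrier [simp, intro]: "st a \<in> vcarrier SF"
  using parity_carrier[of 1] st_odd by simp

lemma gen_carrier [simp, intro]: "v \<in> vcarrier SF \<Longrightarrow> gen a n v \<in> vcarrier SF"
  by (simp add: gen_def)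

lemma st_eq_gen: "gen a (-1) (vac SF) = st a"
  by (simp add: gen_def creation)

lemma gen_anticommute:
  "v \<in> vcarrier SF \<Longrightarrow> gen a m (gen b n v) =
    (if m + n = 0 then vscale SF (of_int m * form a b) v else 0) - gen b n (gen a m v)"
  using anticommutator[of v a m b n] by (simp add: eq_diff_eq)

lemma gen_zero [simp]: "gen a n 0 = 0"
  by (simp add: gen_def)

lemma gen_scale: "v \<in> vcarrier SF \<Longrightarrow> gen a n (vscale SF c v) = vscale SF c (gen a n v)"
  by (simp add: gen_def mode_scale_right)

lemma fock_monomial_simps:
  "fock_monomial [] = vac SF"
  "fock_monomial ((i, n) # xs) = gen (basis_vec i) (- int n) (fock_monomial xs)"
  by (simp_all add: fock_monomial_def)

lemma fock_monomial_carrier: "fock_monomial xs \<in> vcarrier SF"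
  by (induction xs) (auto simp: fock_monomial_simps)

text \<open>The central term carries the factor m = 0, so a zero mode anticommutes with all creation
  operators; it also kills the vacuum, hence every Fock monomial.\<close>

lemma gen_zero_mode:
  assumes "v \<in> vcarrier SF"
  shows "gen a 0 v = 0"
proof -
  have mono: "gen a 0 (fock_monomial xs) = 0" for xs
    by (induction xs) (auto simp: fock_monomial_simps annihilation gen_anticommute fock_monomial_carrier)
  have "v \<in> vs.span (fock_monomial ` fock_words d)" using assms fock_span by simp
  then have "v \<in> vcarrier SF \<and> gen a 0 v = 0"
  proof (induction rule: vs.span_induct_alt)
    case (step c x y)
    then obtain xs where x: "x = fock_monomial xs" by blast
    have "x \<in> vcarrier SF" by (simp add: x fock_monomial_carrier)
    then show ?case
      using step mono[of xs] x by (simp add: gen_def mode_add_right mode_scale_right carrier_closed)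
  qed (simp add: carrier_closed)
  then show ?thesis by blast
qed

lemma gen_st:
  "n \<ge> 0 \<Longrightarrow> gen a n (st b) = (if n = 1 then vscale SF (form a b) (vac SF) else 0)"
  by (simp add: st_eq_gen[symmetric] gen_anticommute annihilation)

text \<open>Linearity reduces this to basis vectors; the minus sign compensates
  \<open>form (f j) (e j)\<close> = -1.\<close>

lemma symplectic_expansion:
  "(\<Sum>i\<in>{1..d}. hscale (form a (f i)) (e i) - hscale (form a (e i)) (f i)) = a"
proof -
  interpret hs: vector_space hscale by (rule h_vector_space)
  let ?E = "\<lambda>a. \<Sum>i\<in>{1..d}. hscale (form a (f i)) (e i) - hscale (form a (e i)) (f i)"
  have add: "?E (hscale c x + y) = hscale c (?E x) + ?E y" for c x y
    unfolding hs.scale_sum_right sum.distrib[symmetric]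
    by (intro sum.cong refl)
      (simp add: form_add form_scale hs.scale_left_distrib hs.scale_right_diff_distrib)
  have basis: "?E x = x" if x: "x \<in> e ` {1..d} \<union> f ` {1..d}" for x
  proof -
    obtain j where j: "j \<in> {1..d}" "x = e j \<or> x = f j" using x by blast
    have fe: "form (f j) (e i) = (if i = j then -1 else 0)" if "i \<in> {1..d}" for i
      using form_skew[of "f j" "e i"] form_ef[OF that j(1)] by simp
    have 1: "(\<Sum>i\<in>{1..d}. if i = j then g i else 0) = g j" for g :: "nat \<Rightarrow> 'a"
      using j(1) by (simp add: sum.delta)
    show ?thesis
    proof (cases "x = e j")
      case True
      have "?E x = (\<Sum>i\<in>{1..d}. if i = j then e i else 0)"
        by (rule sum.cong) (use True j form_ef form_ee in auto)
      then show ?thesis using 1 True by simp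
    next
      case False
      then have "x = f j" using j by simp
      then have "?E x = (\<Sum>i\<in>{1..d}. if i = j then f i else 0)"
        by (intro sum.cong) (use j fe form_ff in auto)
      then show ?thesis using 1 \<open>x = f j\<close> by simp
    qed
  qed
  have "a \<in> hs.span (e ` {1..d} \<union> f ` {1..d})" using h_span by simp
  then show ?thesis
  proof (induction rule: hs.span_induct_alt)
    case base
    show ?case using add[of 0 0 0] add[of 1 0 0] by simp
  next
    case (step c x y)
    then show ?case using add[of c x y] basis[of x] by simp
  qed
qed

text \<open>Moving a_1 to the right past the creation operators of the conformal vector leaves the
  symplectic expansion of a. The formula yields both \<open>L0_st\<close> and
  \<open>deform_conf\<close>.\<close>

lemma gen_conf:
  assumes "n \<ge> 1"
  shows "gen a n (conf SF) = (if n = 1 then st a else 0)"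
proof -
  have st_sum: "st (\<Sum>i\<in>I. g i) = (\<Sum>i\<in>I. st (g i))" for g and I :: "nat set"
  proof -
    have "st 0 = 0" using st_add[of 0 0] by simp
    then show ?thesis by (induction I rule: infinite_finite_induct) (auto simp: st_add)
  qed
  have st_diff: "st (x - y) = st x - st y" for x y
    using st_add[of "x - y" y] by simp
  have "gen a n (conf SF) = (\<Sum>i\<in>{1..d}. gen a n (gen (f i) (-1) (st (e i))))"
    unfolding conf_eq st_eq_gen unfolding gen_def by (rule mode_sum_right) auto
  also have "\<dots> = (\<Sum>i\<in>{1..d}. if n = 1 then st (hscale (form a (f i)) (e i) - hscale (form a (e i)) (f i)) else 0)"
  proof (rule sum.cong)
    fix i
    show "gen a n (gen (f i) (-1) (st (e i))) =
      (if n = 1 then st (hscale (form a (f i)) (e i) - hscale (form a (e i)) (f i)) else 0)"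
      using assms gen_anticommute[of "st (e i)" a n "f i" "-1"] gen_st[of n a "e i"]
      by (auto simp: st_diff st_scale gen_scale st_eq_gen)
  qed simp
  also have "\<dots> = (if n = 1 then st a else 0)"
    using symplectic_expansion[of a] by (simp add: st_sum[symmetric])
  finally show ?thesis .
qed

text \<open>A case of skew-symmetry: the Jacobi identity for (a, \<omega>) on the vacuum at (l, m,
  n) = (1, -1, 0) has a_1 \<omega> = a on the left, as a_2 \<omega> = 0, and only \<omega>_1 a on
  the right.\<close>

lemma L0_st: "L SF 0 (st a) = st a"
proof -
  have "(\<Sum>i\<le>1. vscale SF (of_int (-1) gchoose i) (Y SF (Y SF (st a) (1 + int i) (conf SF)) (-1 + 0 - int i) (vac SF)))
    = (\<Sum>i\<le>1. vscale SF ((-1) ^ i * (of_int 1 gchoose i))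
        (Y SF (st a) (1 + -1 - int i) (Y SF (conf SF) (0 + int i) (vac SF))
         - vscale SF ((-1) ^ (1 * 0) * (-1) powi 1)
            (Y SF (conf SF) (1 + 0 - int i) (Y SF (st a) (-1 + int i) (vac SF)))))"
    by (rule jacobi_finite)
      (use gen_conf[unfolded gen_def] in \<open>auto simp: st_odd[simplified] conf_even creation\<close>)
  then show ?thesis
    using gen_conf[unfolded gen_def, of 1 a] gen_conf[unfolded gen_def, of 2 a]
    by (simp add: creation L_def)
qed

text \<open>In the commutator with \<omega>_1, the term of \<omega>_0 a = L(-1) a contributes -(n+1)
  a_n and that of \<omega>_1 a = a contributes a_n.\<close>

lemma L0_gen:
  assumes v: "v \<in> vcarrier SF"
  shows "L SF 0 (gen a n v) = gen a n (L SF 0 v) - vscale SF (of_int n) (gen a n v)"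
proof -
  have "Y SF (conf SF) (int 1) (Y SF (st a) n v)
    = vscale SF ((-1) ^ (0 * 1)) (Y SF (st a) n (Y SF (conf SF) (int 1) v))
      + (\<Sum>j\<le>1. vscale SF (of_nat (1 choose j)) (Y SF (Y SF (conf SF) (int j) (st a)) (int 1 + n - int j) v))"
    by (rule commutator_formula) (use v st_odd[of a] conf_even in auto)
  also have "\<dots> = Y SF (st a) n (L SF 0 v) + Y SF (L SF (-1) (st a)) (n + 1) v + Y SF (L SF 0 (st a)) n v"
    by (simp add: L_def add_ac)
  also have "\<dots> = Y SF (st a) n (L SF 0 v) - vscale SF (of_int n) (Y SF (st a) n v)"
    using derivative[of "st a" v "n + 1"] v
    by (simp add: L0_st vs.scale_left_distrib vs.scale_left_diff_distrib)
  finally show ?thesis by (simp add: L_def gen_def)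
qed

lemma gen_weight:
  assumes "v \<in> weight_space SF k"
  shows "gen a n v \<in> weight_space SF (k - n)"
proof -
  have v: "v \<in> vcarrier SF" "L SF 0 v = vscale SF (of_int k) v"
    using assms by (auto simp: weight_space_def)
  then show ?thesis
    unfolding weight_space_def
    by (simp add: L0_gen) (simp add: gen_def mode_scale_right vs.scale_left_diff_distrib)
qed

lemma vac_weight: "vac SF \<in> weight_space SF 0"
  by (simp add: weight_space_def L_def creation)

lemma fock_monomial_weight: "fock_monomial xs \<in> weight_space SF (int (\<Sum>(i, n)\<leftarrow>xs. n))"
proof (induction xs)
  case (Cons z xs)
  obtain i n where z: "z = (i, n)" by (cases z)
  show ?case
    using gen_weight[OF Cons.IH, of "basis_vec i" "- int n"] by (simp add: z fock_monomial_simps add_ac)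
qed (simp add: fock_monomial_simps vac_weight)

text \<open>Fock monomials are independent L(0)-eigenvectors, and all except the vacuum have
  positive weight, so the kernel of L(0) consists of multiples of the vacuum.\<close>

lemma weight_zero_even:
  assumes "x \<in> weight_space SF 0"
  shows "x \<in> parity SF 0"
proof -
  let ?B = "fock_monomial ` fock_words d"
  have x: "x \<in> vcarrier SF" "L SF 0 x = 0" using assms by (auto simp: weight_space_def)
  have "x \<in> vs.span ?B" using x fock_span by simp
  then obtain t r where t: "finite t" "t \<subseteq> ?B" "x = (\<Sum>b\<in>t. vscale SF (r b) b)"
    unfolding vs.span_explicit by auto
  have "\<exists>w. b \<in> weight_space SF (int w) \<and> (b = vac SF \<or> w > 0)" if "b \<in> t" for b
  proof -
    obtain xs where xs: "xs \<in> fock_words d" "b = fock_monomial xs" using \<open>b \<in> t\<close> t(2) by blast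
    have "xs = [] \<or> (\<Sum>(i, n)\<leftarrow>xs. n) > 0"
      using xs(1) by (cases xs) (auto simp: fock_words_def)
    then show ?thesis
      using xs(2) fock_monomial_weight[of xs] by (auto simp: fock_monomial_simps(1))
  qed
  then obtain w where w: "\<And>b. b \<in> t \<Longrightarrow> b \<in> weight_space SF (int (w b)) \<and> (b = vac SF \<or> w b > 0)"
    by metis
  have tC: "b \<in> vcarrier SF" if "b \<in> t" for b using w[OF that] weight_space_carrier by blast
  have "0 = (\<Sum>b\<in>t. L SF 0 (vscale SF (r b) b))"
    using x(2) unfolding t(3) by (subst (asm) L_sum) (auto simp: tC carrier_closed)
  also have "\<dots> = (\<Sum>b\<in>t. vscale SF (r b * of_nat (w b)) b)"
    by (rule sum.cong) (use w in \<open>auto simp: weight_space_def L_scale\<close>)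
  finally have "r b * of_nat (w b) = 0" if "b \<in> t" for b
    using vs.independentD[OF fock_independent t(1,2) _ that] by metis
  then have "r b = 0" if "b \<in> t" "b \<noteq> vac SF" for b
    using w[OF that(1)] that by force
  then have "vscale SF (r b) b \<in> parity SF 0" if "b \<in> t" for b
    using that vac_even vs.subspace_scale[OF parity_subspace[of 0]] vs.subspace_0[OF parity_subspace[of 0]]
    by (cases "b = vac SF") auto
  then show ?thesis
    unfolding t(3) by (intro vs.subspace_sum[OF parity_subspace]) auto
qed

text \<open>In the normally ordered expansion of L(0) every term has a mode of index \<ge> 0 on the
  right. Positive modes kill x by assumption and zero modes vanish, so L(0) x = 0.\<close>

lemma annihilated_even:
  assumes x: "x \<in> vcarrier SF" and ann: "\<And>a n. n \<ge> 1 \<Longrightarrow> gen a n x = 0"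
  shows "x \<in> parity SF 0"
proof -
  have "Y SF (gen (f i) (-1) (st (e i))) 1 x = 0" for i
  proof -
    \<comment> \<open>The Jacobi identity at (l, m, n) = (-1, 0, 1): \<open>0 gchoose j\<close>
      leaves only (f_{-1} e)_1 x on the left. The bound 2 suffices because f_{j-1} e = 0 for j >
      2.\<close>
    have "(\<Sum>j\<le>2. vscale SF (of_int 0 gchoose j) (Y SF (Y SF (st (f i)) (-1 + int j) (st (e i))) (0 + 1 - int j) x))
      = (\<Sum>j\<le>2. vscale SF ((-1) ^ j * (of_int (-1) gchoose j))
          (Y SF (st (f i)) (-1 + 0 - int j) (Y SF (st (e i)) (1 + int j) x)
           - vscale SF ((-1) ^ (1 * 1) * (-1) powi (-1))
              (Y SF (st (e i)) (-1 + 1 - int j) (Y SF (st (f i)) (0 + int j) x))))"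
    proof (rule jacobi_finite)
      fix j :: nat assume j: "2 < j"
      show "Y SF (st (f i)) (-1 + int j) (st (e i)) = 0"
        using gen_st[of "-1 + int j" "f i" "e i"] j by (simp add: gen_def)
      show "Y SF (st (e i)) (1 + int j) x = 0" "Y SF (st (f i)) (0 + int j) x = 0"
        using ann j by (simp_all add: gen_def)
    qed (use st_odd x in simp_all)
    moreover have "Y SF (st (e i)) (1 + int j) x = 0" "Y SF (st (f i)) (int j) x = 0" for j
      using ann[of "1 + int j" "e i"] ann[of "int j" "f i"] gen_zero_mode[OF x, of "f i"]
      by (simp_all add: gen_def) (cases "j = 0"; simp)
    ultimately show ?thesis
      by (simp add: gen_def gbinomial_0_left numeral_2_eq_2)
  qed
  then have "L SF 0 x = 0"
    unfolding L_def conf_eq st_eq_gen by (simp add: mode_sum_left x)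
  then show ?thesis using x by (intro weight_zero_even) (simp add: weight_space_def)
qed

lemma vac_nonzero: "vac SF \<noteq> 0"
proof
  assume "vac SF = 0"
  moreover have "[] \<in> fock_words d" by (simp add: fock_words_def)
  ultimately have "0 \<in> fock_monomial ` fock_words d"
    using fock_monomial_simps(1) by (metis imageI)
  then show False using fock_independent vs.dependent_zero by blast
qed

section \<open>Encoding pairs of states in \<open>nat \<Rightarrow> complex\<close>\<close>

definition coord :: "'b \<Rightarrow> nat \<Rightarrow> complex" where
  "coord v n = vs.representation (vs.extend_basis (fock_monomial ` fock_words d)) v (fock_monomial (from_nat n))"

text \<open>Extending the monomials to a basis of the whole type makes \<open>coord\<close> linear
  everywhere, as \<open>code_add\<close> and \<open>code_scale\<close> demand without a carrier
  condition.\<close>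

lemma coord_add: "coord (u + v) n = coord u n + coord v n"
  unfolding coord_def using vs.independent_extend_basis[OF fock_independent]
  by (subst vs.representation_add) (simp_all add: vs.span_extend_basis[OF fock_independent])

lemma coord_scale: "coord (vscale SF a v) n = a * coord v n"
  unfolding coord_def using vs.independent_extend_basis[OF fock_independent]
  by (subst vs.representation_scale) (simp_all add: vs.span_extend_basis[OF fock_independent])

text \<open>On the carrier the extended representation agrees with the one in the monomials, and
  \<open>from_nat\<close> reaches every word, so each coefficient occurs as some
  \<open>coord v n\<close>.\<close>

lemma coord_eq_0:
  assumes "v \<in> vcarrier SF" "\<And>n. coord v n = 0"
  shows "v = 0"
proof -
  let ?B = "fock_monomial ` fock_words d"
  have v: "v \<in> vs.span ?B" using assms fock_span by simp
  have R: "vs.representation (vs.extend_basis ?B) v = vs.representation ?B v"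
    by (rule vs.representation_extend[OF vs.independent_extend_basis[OF fock_independent] v
          vs.extend_basis_superset[OF fock_independent]])
  have "vs.representation ?B v b = 0" for b
  proof (cases "b \<in> ?B")
    case True
    then obtain xs where "b = fock_monomial xs" by blast
    then show ?thesis
      using assms(2)[of "to_nat xs"] unfolding coord_def R by simp
  qed (use vs.representation_ne_zero in blast)
  then show ?thesis
    using vs.sum_nonzero_representation_eq[OF fock_independent v] by simp
qed

definition interleave :: "'b \<Rightarrow> 'b \<Rightarrow> nat \<Rightarrow> complex" where
  "interleave x y n = (if even n then coord x (n div 2) else coord y (n div 2))"

lemma interleave_eq_0:
  assumes "x \<in> vcarrier SF" "y \<in> vcarrier SF" "interleave x y = 0"
  shows "x = 0 \<and> y = 0"
proof -
  have "coord x n = 0" "coord y n = 0" for n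
    using fun_cong[OF assms(3), of "2 * n"] fun_cong[OF assms(3), of "2 * n + 1"]
    by (simp_all add: interleave_def)
  then show ?thesis using coord_eq_0 assms by blast
qed

end

section \<open>Deforming symplectic fermions along a pair (p, q)\<close>

locale paired_symplectic_fermion = symplectic_fermion +
  fixes p q :: 'a
  assumes form_pq: "form p q = 1"
begin

sublocale odd_deformation SF "st p"
  by unfold_locales (use st_odd gen_zero_mode in \<open>auto simp: gen_def\<close>)

text \<open>Only k = 1 contributes, with p_1 a = \<open>form p a\<close> times the vacuum. In
  particular the deformed zero mode of q is multiplication by \<theta>, up to sign on odd
  states.\<close>

lemma deform_st:
  assumes "x \<in> vcarrier SF"
  shows "deform (st a) m x = (if m = 0 then vscale SF (form p a) x else 0)"
proof -
  have "deform (st a) m x = (\<Sum>k\<le>1. vscale SF (log_coeff k) (Y SF (Y SF (st p) (int k) (st a)) (m - int k) x))"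
    by (rule deform_eq) (use gen_st[of _ "p" a] assms in \<open>auto simp: gen_def\<close>)
  then show ?thesis
    using gen_st[of 1 "p" a] assms
    by (auto simp: gen_def mode_scale_left vac_mode log_coeff_def)
qed

text \<open>Only k = 1 contributes, where p_1 \<omega> = p; what remains is the zero mode of p on x,
  which vanishes.\<close>

lemma deform_conf:
  assumes "x \<in> vcarrier SF"
  shows "deform (conf SF) 1 x = 0"
proof -
  have "deform (conf SF) 1 x = (\<Sum>k\<le>1. vscale SF (log_coeff k) (Y SF (Y SF (st p) (int k) (conf SF)) (1 - int k) x))"
    by (rule deform_eq) (use gen_conf[of _ "p"] assms in \<open>auto simp: gen_def\<close>)
  then show ?thesis
    using gen_conf[of 1 "p"] gen_zero_mode[OF assms, of "p"] by (simp add: gen_def)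
qed

sublocale M: deformed_module SF "st p" "- 2 * of_nat d" "\<lambda>a w n. a * w n" interleave
proof unfold_locales
  show "x = 0 \<and> y = 0"
    if "x \<in> vcarrier SF" "y \<in> vcarrier SF" "interleave x y = 0" for x y
    using that by (rule interleave_eq_0)
qed (auto simp: fun_eq_iff interleave_def coord_add coord_scale deform_conf algebra_simps)

text \<open>In the Jacobi identity at $(k - m, m, n)$ with \<open>m\<close> so large that the modes $a_{m+i}$ kill
  the vector, the left-hand side consists of lowering modes of even states, and the right-hand side
  of the products $a_{k-i}b_{n+i}$. Hence downward induction on \<open>n\<close>.\<close>

lemma mode_products_vanish:
  assumes w: "interleave x y \<in> Omega (even_part SF) M.deformed" "x \<in> vcarrier SF" "y \<in> vcarrier SF"
    and "k + n \<ge> 1"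
  shows "Y SF (st a) k (Y SF (st b) n y) - Y SF (st a) k (deform (st b) n x)
    + deform (st a) k (Y SF (st b) n x) = 0"
proof -
  let ?u = "st a" and ?v = "st b"
  \<comment> \<open>The \<theta>-coefficient of a_k b_n applied to x + \<theta> y; the minus sign
    comes from moving \<theta> past the odd mode a_k.\<close>
  define P where "P k n = Y SF ?u k (Y SF ?v n y) - Y SF ?u k (deform ?v n x)
    + deform ?u k (Y SF ?v n x)" for k n
  obtain N1 where N1: "\<forall>n\<ge>N1. Y SF ?v n x = 0" using truncation[of ?v x] w by auto
  obtain N2 where N2: "\<forall>n\<ge>N2. Y SF ?v n y = 0" using truncation[of ?v y] w by auto
  \<comment> \<open>The lower bound 1 avoids index 0, the only one at which
    \<open>deform (st b)\<close> can be nonzero; \<open>m\<close> below is bounded for the same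
    reason.\<close>
  define n0 where "n0 = max 1 (max N1 N2)"
  have top: "P k n = 0" if "n \<ge> n0" for k n
    using N1 N2 that w by (simp add: P_def n0_def deform_st)
  have "\<forall>k n. n0 - n \<le> int j \<longrightarrow> k + n \<ge> 1 \<longrightarrow> P k n = 0" for j
  proof (induction j)
    case 0
    then show ?case using top by simp
  next
    case (Suc j)
    show ?case
    proof (intro allI impI)
      fix k n assume kn: "n0 - n \<le> int (Suc j)" "k + n \<ge> 1"
      obtain M1 where M1: "\<forall>n\<ge>M1. Y SF ?u n x = 0" using truncation[of ?u x] w by auto
      obtain M2 where M2: "\<forall>n\<ge>M2. Y SF ?u n y = 0" using truncation[of ?u y] w by auto
      define m where "m = max 1 (max M1 M2)"
      define l where "l = k - m"
      have m: "Y SF ?u (m + int i) x = 0" "Y SF ?u (m + int i) y = 0" "deform ?u (m + int i) x = 0" for i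
      proof -
        have "m + int i \<noteq> 0" "m + int i \<ge> M1" "m + int i \<ge> M2" unfolding m_def by linarith+
        then show "Y SF ?u (m + int i) x = 0" "Y SF ?u (m + int i) y = 0" "deform ?u (m + int i) x = 0"
          using M1 M2 w by (simp_all add: deform_st)
      qed
      let ?D = "\<lambda>N. (\<Sum>i\<le>N. vscale SF (of_int m gchoose i) (deform (Y SF ?u (l + int i) ?v) (m + n - int i) x))
        = (\<Sum>i\<le>N. vscale SF ((-1) ^ i * (of_int l gchoose i))
            (deform ?u (l + m - int i) (Y SF ?v (n + int i) x)
             + vscale SF ((-1) ^ 1) (Y SF ?u (l + m - int i) (deform ?v (n + int i) x))
             - vscale SF ((-1) ^ (1 * 1) * (-1) powi l)
                (deform ?v (l + n - int i) (Y SF ?u (m + int i) x)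
                 + vscale SF ((-1) ^ 1) (Y SF ?v (l + n - int i) (deform ?u (m + int i) x)))))"
      have "\<forall>\<^sub>F N in sequentially. ?D N \<and> (\<forall>i>N. Y SF ?u (l + int i) ?v = 0)
        \<and> (\<forall>i>N. Y SF ?v (n + int i) y = 0) \<and> (\<forall>i>N. Y SF ?u (m + int i) y = 0)"
        by (intro eventually_conj deform_jacobi mode_eventually_zero st_carrier w) (use st_odd in simp_all)
      from eventually_happens'[OF sequentially_bot this] obtain N where D: "?D N"
        and t: "\<And>i. i > N \<Longrightarrow> Y SF ?u (l + int i) ?v = 0" "\<And>i. i > N \<Longrightarrow> Y SF ?v (n + int i) y = 0"
          "\<And>i. i > N \<Longrightarrow> Y SF ?u (m + int i) y = 0"
        by (elim exE conjE) blast
      have J: "(\<Sum>i\<le>N. vscale SF (of_int m gchoose i) (Y SF (Y SF ?u (l + int i) ?v) (m + n - int i) y))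
        = (\<Sum>i\<le>N. vscale SF ((-1) ^ i * (of_int l gchoose i))
            (Y SF ?u (l + m - int i) (Y SF ?v (n + int i) y)
             - vscale SF ((-1) ^ (1 * 1) * (-1) powi l) (Y SF ?v (l + n - int i) (Y SF ?u (m + int i) y))))"
        by (rule jacobi_finite) (use st_odd w t in auto)
      \<comment> \<open>The even state a_{l+i} b has weight 1 - l - i, so its mode of index m + n -
        i lowers weights by l + m + n = k + n \<ge> 1.\<close>
      have "Y SF (Y SF ?u (l + int i) ?v) (m + n - int i) y
        + deform (Y SF ?u (l + int i) ?v) (m + n - int i) x = 0" for i
      proof (rule M.Omega_D[OF w])
        have "?v \<in> weight_space SF 1" by (simp add: weight_space_def L0_st)
        then show "Y SF ?u (l + int i) ?v \<in> weight_space SF (1 - (l + int i))"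
          using gen_weight unfolding gen_def by blast
        show "Y SF ?u (l + int i) ?v \<in> parity SF 0"
          using mode_parity[of 1 1 ?u ?v "l + int i"] st_odd by simp
        show "1 - (l + int i) - (m + n - int i) - 1 < 0" using kn(2) by (simp add: l_def)
      qed
      then have "0 = (\<Sum>i\<le>N. vscale SF (of_int m gchoose i) (Y SF (Y SF ?u (l + int i) ?v) (m + n - int i) y
        + deform (Y SF ?u (l + int i) ?v) (m + n - int i) x))"
        by simp
      also have "\<dots> = (\<Sum>i\<le>N. vscale SF ((-1) ^ i * (of_int l gchoose i)) (P (k - int i) (n + int i)))"
        unfolding vs.scale_right_distrib sum.distrib D J
        unfolding sum.distrib[symmetric] vs.scale_right_distrib[symmetric]
        by (intro sum.cong refl arg_cong2[where f = "vscale SF"]) (simp add: m w P_def l_def algebra_simps)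
      \<comment> \<open>For i > 0 the index n + i is closer to \<open>n0\<close> while the index sum
        is still k + n, so the induction hypothesis applies.\<close>
      also have "\<dots> = (\<Sum>i\<in>{0}. vscale SF ((-1) ^ i * (of_int l gchoose i)) (P (k - int i) (n + int i)))"
      proof (rule sum.mono_neutral_right)
        have "P (k - int i) (n + int i) = 0" if "i > 0" for i
          using Suc.IH kn that by auto
        then show "\<forall>i\<in>{..N} - {0}. vscale SF ((-1) ^ i * (of_int l gchoose i)) (P (k - int i) (n + int i)) = 0"
          by simp
      qed auto
      finally show "P k n = 0" by simp
    qed
  qed
  from this[rule_format, of n "nat (n0 - n)" k] show ?thesis
    using assms(4) by (simp add: P_def)
qed

lemma Omega_even:
  assumes w: "x \<in> vcarrier SF" "y \<in> vcarrier SF" "interleave x y \<in> Omega (even_part SF) M.deformed"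
  shows "x \<in> parity SF 0"
proof (rule annihilated_even[OF w(1)])
  fix a and n :: int assume n: "n \<ge> 1"
  \<comment> \<open>For b = q and second index 0, the terms containing q_0 x and q_0 y vanish, and
    \<open>deform (st q) 0 x\<close> = x leaves -a_n x = 0.\<close>
  show "gen a n x = 0"
    using mode_products_vanish[OF w(3,1,2), of n 0 a "q"] n gen_zero_mode[of _ "q"] w
    by (simp add: gen_def deform_st form_pq)
qed

text \<open>The odd state of q is nonzero because p_1 maps it to the vacuum.\<close>

lemma not_all_even: "\<not> vcarrier SF \<subseteq> parity SF 0"
proof
  assume "vcarrier SF \<subseteq> parity SF 0"
  then have "st q = 0" using st_odd[of "q"] parity_disjoint by auto
  then have "vac SF = 0"
    using gen_st[of 1 "p" "q"] form_pq by simp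
  then show False using vac_nonzero by simp
qed

end

theorem corollary1p14:
  fixes d :: nat
    and hscale :: "complex \<Rightarrow> 'h::ab_group_add \<Rightarrow> 'h"
    and form :: "'h \<Rightarrow> 'h \<Rightarrow> complex"
    and e f :: "nat \<Rightarrow> 'h"
    and SF :: "('v::ab_group_add) vosa"
    and st :: "'h \<Rightarrow> 'v"
  assumes "d \<ge> 1"
    and "symplectic_fermion hscale form d e f SF st"
  shows "\<exists>M :: 'v countable_vmod. M \<in> Mod (even_part SF) \<and> \<not> lowest_generated (even_part SF) M"
proof -
  interpret symplectic_fermion hscale form d e f SF st by (rule assms(2))
  \<comment> \<open>The assumption \<open>d \<ge> 1\<close> provides the pair p =
    \<open>e 1\<close>, q = \<open>f 1\<close>.\<close>
  have "form (e 1) (f 1) = 1" using form_ef[of 1 1] \<open>d \<ge> 1\<close> by simp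
  then interpret paired_symplectic_fermion hscale form d e f SF st "e 1" "f 1"
    by (intro paired_symplectic_fermion.intro paired_symplectic_fermion_axioms.intro assms(2))
  show ?thesis
    by (intro exI[of _ M.deformed] conjI M.deformed_in_Mod M.not_lowest_generated Omega_even
        not_all_even)
qed

end
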